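(* Let $G$ be a strongly connected graph such that $M(G)$ is a cycle of bunches, and let $q = \mathrm{per}(G)/\mathrm{per}(M(G))$. Then $O_{M(G),q} \leq_S G$.
   Context: All graphs are finite directed graphs $G$ consisting of a finite set $V(G)$ of states, a finite set $E(G)$ of edges and maps $s,t:E(G)\to V(G)$ (source and target); loops and parallel edges are allowed, and all graphs are assumed sink-free (every state has an outgoing edge). Write $E_I(G)=s^{-1}(I)$, $F(I)=t(E_I(G))$ (followers of $I$), $L(G)$ for the set of finite edge paths $e_1\cdots e_n$ with $t(e_i)=s(e_{i+1})$, and $L_I(G)$ for the paths starting at $I$; $s,t$ extend to paths. A graph homomorphism $\Phi:G\to H$ is a pair of maps $\Phi:E(G)\to E(H)$, $\partial\Phi:V(G)\to V(H)$ with $s\circ\Phi=\partial\Phi\circ s$, $t\circ\Phi=\partial\Phi\circ t$; it induces a map on paths. Graphs are identified up to isomorphism. A right-resolver $\Phi:G\to H$ is a surjective homomorphism such that for every $I\in V(G)$, $\Phi|_{E_I(G)}$ is a bijection onto $E_{\partial\Phi(I)}(H)$; write $\hom_R(G,H)$ for the set of these and $H\leq_R G$ if it is nonempty ($\leq_R$ is a partial order). For every graph $G$ there is a unique $\leq_R$-minimal graph $M(G)$ with $M(G)\leq_R G$. For $\Phi\in\hom_R(G,H)$, $I\in V(G)$ and $u\in L_{\partial\Phi(I)}(H)$, $I\cdot u$ denotes the terminal state of the unique $\gamma\in L_I(G)$ with $\Phi(\gamma)=u$. The stability relation $\sim_\Phi$ on $V(G)$: $I_1\sim_\Phi I_2$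 iff $\partial\Phi(I_1)=\partial\Phi(I_2)=:I$ and for every $u\in L_I(H)$ there exists $v\in L_{t(u)}(H)$ with $I_1\cdot uv=I_2\cdot uv$. $\Phi$ is a synchronizer if each fiber $(\partial\Phi)^{-1}(I)$, $I\in V(H)$, is a single $\sim_\Phi$ class; $H\leq_S G$ means there is a synchronizing right-resolver $G\to H$. A graph is strongly connected if there is a path from any state to any state; its period $\mathrm{per}(G)$ is the gcd of its cycle lengths. A cycle of bunches is a strongly connected graph in which every state $I$ has $|F(I)|=1$. If $M$ is a $\leq_R$-minimal cycle of bunches with states $I_0,\dots,I_{p-1}$, $F(I_i)=\{I_{i+1}\}$ (indices mod $p$) and out-degrees $D_i=|E_{I_i}(M)|$, then $O_{M,q}$ denotes the cycle of bunches of length $pq$ whose sequence of out-degrees is $D_0,\dots,D_{p-1}$ repeated cyclically $q$ times. *)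

theory Defs
  imports "Graph_Theory.Graph_Theory"
begin

definition sink_free_graph :: "('a,'b) pre_digraph \<Rightarrow> bool" where
  "sink_free_graph G \<longleftrightarrow> fin_digraph G \<and> (\<forall>I \<in> verts G. out_arcs G I \<noteq> {})"

definition followers :: "('a,'b) pre_digraph \<Rightarrow> 'a \<Rightarrow> 'a set" where
  "followers G I = head G ` out_arcs G I"

text \<open>A homomorphism is a pair of maps \<open>\<phi>\<close> on edges and \<open>\<psi>\<close> on states
  (\<open>\<Phi>\<close> and \<open>\<partial>\<Phi>\<close> in the usual notation); their values off
  \<open>arcs G\<close> and \<open>verts G\<close> are irrelevant.\<close>

definition graph_hom ::
  "('a,'b) pre_digraph \<Rightarrow> ('c,'d) pre_digraph \<Rightarrow> ('b \<Rightarrow> 'd) \<Rightarrow> ('a \<Rightarrow> 'c) \<Rightarrow> bool" where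
  "graph_hom G H \<phi> \<psi> \<longleftrightarrow>
     \<phi> ` arcs G \<subseteq> arcs H \<and> \<psi> ` verts G \<subseteq> verts H \<and>
     (\<forall>e \<in> arcs G. tail H (\<phi> e) = \<psi> (tail G e) \<and> head H (\<phi> e) = \<psi> (head G e))"

definition right_resolver ::
  "('a,'b) pre_digraph \<Rightarrow> ('c,'d) pre_digraph \<Rightarrow> ('b \<Rightarrow> 'd) \<Rightarrow> ('a \<Rightarrow> 'c) \<Rightarrow> bool" where
  "right_resolver G H \<phi> \<psi> \<longleftrightarrow>
     sink_free_graph G \<and> sink_free_graph H \<and> graph_hom G H \<phi> \<psi> \<and>
     \<phi> ` arcs G = arcs H \<and> \<psi> ` verts G = verts H \<and>
     (\<forall>I \<in> verts G. bij_betw \<phi> (out_arcs G I) (out_arcs H (\<psi> I)))"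

definition le_R :: "('c,'d) pre_digraph \<Rightarrow> ('a,'b) pre_digraph \<Rightarrow> bool" (infix "\<le>\<^sub>R" 50) where
  "H \<le>\<^sub>R G \<longleftrightarrow> (\<exists>\<phi> \<psi>. right_resolver G H \<phi> \<psi>)"

text \<open>Letting \<open>K\<close> range over graphs of the same type as \<open>M\<close> loses no generality: if
  \<open>K \<le>\<^sub>R M\<close> then \<open>K\<close> is an image of \<open>M\<close>, so it has an isomorphic copy whose states and
  edges are chosen among those of \<open>M\<close>. Graphs are identified up to isomorphism.\<close>

definition R_minimal :: "('a,'b) pre_digraph \<Rightarrow> bool" where
  "R_minimal M \<longleftrightarrow> sink_free_graph M \<and> (\<forall>K :: ('a,'b) pre_digraph. K \<le>\<^sub>R M \<longrightarrow> digraph_iso K M)"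

text \<open>\<open>is_M G M\<close> says that \<open>M\<close> is a copy of \<open>M(G)\<close>, which is determined only up to
  isomorphism.\<close>

definition is_M :: "('a,'b) pre_digraph \<Rightarrow> ('c,'d) pre_digraph \<Rightarrow> bool" where
  "is_M G M \<longleftrightarrow> R_minimal M \<and> M \<le>\<^sub>R G"

text \<open>\<open>act G \<phi> I u\<close> is \<open>I \<cdot> u\<close>. Paths may be empty.\<close>

definition act :: "('a,'b) pre_digraph \<Rightarrow> ('b \<Rightarrow> 'd) \<Rightarrow> 'a \<Rightarrow> 'd list \<Rightarrow> 'a" where
  "act G \<phi> I u =
     pre_digraph.awlast G I (THE \<gamma>. (\<exists>J. pre_digraph.awalk G I \<gamma> J) \<and> map \<phi> \<gamma> = u)"

definition stable ::
  "('a,'b) pre_digraph \<Rightarrow> ('c,'d) pre_digraph \<Rightarrow> ('b \<Rightarrow> 'd) \<Rightarrow> ('a \<Rightarrow> 'c) \<Rightarrow> ('a \<times> 'a) set" where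
  "stable G H \<phi> \<psi> =
     {(I\<^sub>1, I\<^sub>2). I\<^sub>1 \<in> verts G \<and> I\<^sub>2 \<in> verts G \<and> \<psi> I\<^sub>1 = \<psi> I\<^sub>2 \<and>
        (\<forall>u J. pre_digraph.awalk H (\<psi> I\<^sub>1) u J \<longrightarrow>
           (\<exists>v K. pre_digraph.awalk H J v K \<and> act G \<phi> I\<^sub>1 (u @ v) = act G \<phi> I\<^sub>2 (u @ v)))}"

definition synchronizer ::
  "('a,'b) pre_digraph \<Rightarrow> ('c,'d) pre_digraph \<Rightarrow> ('b \<Rightarrow> 'd) \<Rightarrow> ('a \<Rightarrow> 'c) \<Rightarrow> bool" where
  "synchronizer G H \<phi> \<psi> \<longleftrightarrow>
     right_resolver G H \<phi> \<psi> \<and>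
     (\<forall>I \<in> verts H. {J \<in> verts G. \<psi> J = I} \<in> verts G // stable G H \<phi> \<psi>)"

definition le_S :: "('c,'d) pre_digraph \<Rightarrow> ('a,'b) pre_digraph \<Rightarrow> bool" (infix "\<le>\<^sub>S" 50) where
  "H \<le>\<^sub>S G \<longleftrightarrow> (\<exists>\<phi> \<psi>. synchronizer G H \<phi> \<psi>)"

text \<open>Cycles are closed paths of positive length, not necessarily simple (in contrast to
  \<^const>\<open>pre_digraph.cycle\<close>).\<close>

definition period :: "('a,'b) pre_digraph \<Rightarrow> nat" where
  "period G = Gcd {length c | c I. c \<noteq> [] \<and> pre_digraph.awalk G I c I}"

definition cycle_of_bunches :: "('a,'b) pre_digraph \<Rightarrow> bool" where
  "cycle_of_bunches G \<longleftrightarrow>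
     sink_free_graph G \<and> strongly_connected G \<and> (\<forall>I \<in> verts G. card (followers G I) = 1)"

text \<open>The cycle of bunches with states \<open>0, \<dots>, n - 1\<close> (\<open>n = length D\<close>), having \<open>D ! i\<close>
  parallel edges from \<open>i\<close> to \<open>i + 1\<close> modulo \<open>n\<close>.\<close>

definition bunches :: "nat list \<Rightarrow> (nat, nat \<times> nat) pre_digraph" where
  "bunches D =
     \<lparr> verts = {..<length D},
       arcs = {(i, k). i < length D \<and> k < D ! i},
       tail = fst,
       head = (\<lambda>(i, k). Suc i mod length D) \<rparr>"

text \<open>In a cycle of bunches every state has one follower, so a state \<open>I\<^sub>0\<close> determines the
  cyclic enumeration \<open>I\<^sub>0, \<dots>, I\<^bsub>p-1\<^esub>\<close> of all states.\<close>

definition out_degrees_from :: "('a,'b) pre_digraph \<Rightarrow> 'a \<Rightarrow> nat list" where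
  "out_degrees_from M I\<^sub>0 =
     map (\<lambda>i. out_degree M (((\<lambda>I. the_elem (followers M I)) ^^ i) I\<^sub>0)) [0..<card (verts M)]"

text \<open>\<open>O_graph M I\<^sub>0 q\<close> is \<open>O\<^bsub>M,q\<^esub>\<close>; up to isomorphism the choice of the initial state
  \<open>I\<^sub>0\<close> does not matter.\<close>

definition O_graph :: "('a,'b) pre_digraph \<Rightarrow> 'a \<Rightarrow> nat \<Rightarrow> (nat, nat \<times> nat) pre_digraph" where
  "O_graph M I\<^sub>0 q = bunches (concat (replicate q (out_degrees_from M I\<^sub>0)))"

end

theory Submission
  imports Defs
begin

text \<open>The period of \<open>G\<close> gives every state a position modulo \<open>N = per(G)\<close>, and the right-resolver onto
  \<open>M\<close> shows that the out-degree of a state depends only on its position. A right-resolver onto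
  \<open>O\<^bsub>M,q\<^esub>\<close> over the position map is then nothing but a colouring of the edges leaving each
  state, so the theorem is a road colouring theorem in which the number of colours varies along the
  period. It follows by Trahtman's method. If some colouring has two distinct stable states, pass to
  the quotient by its stability relation and lift a synchronizing colouring of that smaller graph. A
  stable pair arises from two bunches with the same target, or else from a selection of one
  outgoing edge per state such that the states farthest from the cycles of the selection all lie in
  the same tree: for the word reading only selected edges, the images of a clique (an image of a
  fiber of least size) then differ in exactly one state.\<close>

section \<open>Iterating a self-map of a finite set\<close>

text \<open>The factor q is forced: words of equal length preserve the difference of positions, so
  two states over the same state of M but at different positions can never merge. Conversely it
  suffices, because N is the exact period: if every state has a single successor, no two states
  share a position, and otherwise some redirection is possible. To find a selection, the number of
  cyclic states is maximized and one edge is redirected into a deepest state. Either a unique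
  deepest tree arises, or the cycles grow, or an arc of a cycle is exchanged for a branch of exactly
  the same length. This rigidity of the third outcome is what produces two bunches with a common
  target. Since the number of colours varies, letters are arbitrary numbers read modulo the
  out-degree. Every word can then be read everywhere, and stability, images and cliques are handled
  as for a complete automaton; words become paths again only for \<open>bunches\<close>.\<close>

definition cyc :: "'a set \<Rightarrow> ('a \<Rightarrow> 'a) \<Rightarrow> 'a set" where
  "cyc V f = {x \<in> V. \<exists>n>0. (f ^^ n) x = x}"

definition lev :: "'a set \<Rightarrow> ('a \<Rightarrow> 'a) \<Rightarrow> 'a \<Rightarrow> nat" where
  "lev V f x = (LEAST n. (f ^^ n) x \<in> cyc V f)"

definition root :: "'a set \<Rightarrow> ('a \<Rightarrow> 'a) \<Rightarrow> 'a \<Rightarrow> 'a" where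
  "root V f x = (f ^^ lev V f x) x"

text \<open>The free threshold \<open>L\<close> allows the depth bound from before a redirection to
  be used, without computing the new maximal level.\<close>

definition unique_deepest_tree :: "'a set \<Rightarrow> ('a \<Rightarrow> 'a) \<Rightarrow> bool" where
  "unique_deepest_tree V f \<longleftrightarrow>
     (\<exists>L r. (\<exists>x\<in>V. L < lev V f x) \<and> (\<forall>x\<in>V. L < lev V f x \<longrightarrow> root V f x = r))"

lemma funpow_add_apply: "(f ^^ (m + n)) x = (f ^^ m) ((f ^^ n) x)"
  by (simp add: funpow_add)

lemma funpow_Suc_apply: "(f ^^ Suc n) x = f ((f ^^ n) x)"
  by simp

lemma cyc_subset: "cyc V f \<subseteq> V"
  by (auto simp: cyc_def)

lemma funpow_in: "f \<in> V \<rightarrow> V \<Longrightarrow> x \<in> V \<Longrightarrow> (f ^^ n) x \<in> V"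
  by (induction n) auto

lemma cyc_step:
  assumes "f \<in> V \<rightarrow> V" "x \<in> cyc V f"
  shows "f x \<in> cyc V f"
proof -
  from assms obtain n where n: "n > 0" "(f ^^ n) x = x" "x \<in> V" by (auto simp: cyc_def)
  then have "(f ^^ n) (f x) = f x" by (metis funpow_swap1)
  with n assms show ?thesis by (auto simp: cyc_def)
qed

lemma cyc_funpow: "f \<in> V \<rightarrow> V \<Longrightarrow> x \<in> cyc V f \<Longrightarrow> (f ^^ n) x \<in> cyc V f"
  by (induction n) (auto simp: cyc_step)

lemma funpow_collision_cyc:
  assumes "f \<in> V \<rightarrow> V" "x \<in> V" "i < j" "(f ^^ i) x = (f ^^ j) x"
  shows "(f ^^ i) x \<in> cyc V f"
proof -
  have "(f ^^ (j - i)) ((f ^^ i) x) = (f ^^ i) x"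
    using assms funpow_add_apply[of "j - i" i f x] by simp
  then show ?thesis using assms funpow_in[OF assms(1,2)] by (auto simp: cyc_def intro!: exI[of _ "j - i"])
qed

lemma eventually_cyc:
  assumes "finite V" "f \<in> V \<rightarrow> V" "x \<in> V"
  shows "\<exists>n. (f ^^ n) x \<in> cyc V f"
proof -
  have "(\<lambda>n. (f ^^ n) x) ` UNIV \<subseteq> V" using funpow_in[OF assms(2,3)] by auto
  then have "\<not> inj (\<lambda>n. (f ^^ n) x)"
    using assms(1) finite_imageD finite_subset infinite_UNIV_nat by blast
  then obtain i j where ij: "i < j" "(f ^^ i) x = (f ^^ j) x"
    by (metis (mono_tags, lifting) injI nat_neq_iff)
  then show ?thesis using funpow_collision_cyc[OF assms(2,3)] by blast
qed

lemma funpow_in_cyc_iff: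
  assumes "finite V" "f \<in> V \<rightarrow> V" "x \<in> V"
  shows "(f ^^ n) x \<in> cyc V f \<longleftrightarrow> lev V f x \<le> n"
proof
  assume "(f ^^ n) x \<in> cyc V f" then show "lev V f x \<le> n"
    unfolding lev_def by (rule Least_le)
next
  assume "lev V f x \<le> n"
  moreover have "(f ^^ lev V f x) x \<in> cyc V f"
    unfolding lev_def using eventually_cyc[OF assms] by (rule LeastI_ex)
  ultimately show "(f ^^ n) x \<in> cyc V f"
    using cyc_funpow[OF assms(2), of "(f ^^ lev V f x) x" "n - lev V f x"]
      funpow_add_apply[of "n - lev V f x" "lev V f x" f x] by simp
qed

lemma lev_eq_0_iff:
  assumes "finite V" "f \<in> V \<rightarrow> V" "x \<in> V"
  shows "lev V f x = 0 \<longleftrightarrow> x \<in> cyc V f"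
  using funpow_in_cyc_iff[OF assms, of 0] by simp

lemma lev_eqI:
  assumes "finite V" "f \<in> V \<rightarrow> V" "x \<in> V"
    and "(f ^^ n) x \<in> cyc V f" "\<And>i. i < n \<Longrightarrow> (f ^^ i) x \<notin> cyc V f"
  shows "lev V f x = n"
  using assms funpow_in_cyc_iff[OF assms(1-3)] by (meson le_antisym linorder_not_less order_refl)

lemma lev_funpow:
  assumes "finite V" "f \<in> V \<rightarrow> V" "x \<in> V"
  shows "lev V f ((f ^^ n) x) = lev V f x - n"
proof -
  have "lev V f ((f ^^ n) x) \<le> m \<longleftrightarrow> lev V f x - n \<le> m" for m
    using funpow_in_cyc_iff[OF assms(1,2) funpow_in[OF assms(2,3)], of m n]
       funpow_in_cyc_iff[OF assms, of "m + n"] by (simp add: funpow_add_apply le_diff_conv)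
  then show ?thesis by (meson le_antisym order_refl)
qed

lemma cyc_common_period:
  assumes "finite V"
  shows "\<exists>m>0. \<forall>z\<in>cyc V f. (f ^^ m) z = z"
proof -
  have "\<exists>n. 0 < n \<and> (f ^^ n) z = z" if "z \<in> cyc V f" for z using that by (auto simp: cyc_def)
  then obtain p where p: "\<And>z. z \<in> cyc V f \<Longrightarrow> 0 < p z \<and> (f ^^ p z) z = z" by metis
  have fin: "finite (cyc V f)" using assms cyc_subset finite_subset by metis
  have "(f ^^ prod p (cyc V f)) z = z" if "z \<in> cyc V f" for z
  proof -
    have "p z dvd prod p (cyc V f)" using fin that by (rule dvd_prodI)
    then obtain k where k: "prod p (cyc V f) = p z * k" by blast
    have "((f ^^ p z) ^^ k) z = z" using p[OF that] by (induction k) auto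
    then show ?thesis by (simp add: k funpow_mult)
  qed
  moreover have "prod p (cyc V f) > 0" using p by (simp add: prod_pos)
  ultimately show ?thesis by blast
qed

lemma single_orbit:
  assumes fV: "f \<in> V \<rightarrow> V" and x: "x \<in> cyc V f" and orbit: "\<And>z. z \<in> V \<Longrightarrow> \<exists>i. (f ^^ i) x = z"
  obtains n where "0 < n" "\<And>l. (f ^^ (l mod n)) x = (f ^^ l) x" "card V = n"
    "\<And>z l. z \<in> V \<Longrightarrow> (f ^^ l) z = z \<Longrightarrow> n dvd l"
proof -
  define n where "n = (LEAST n. 0 < n \<and> (f ^^ n) x = x)"
  have "\<exists>n. 0 < n \<and> (f ^^ n) x = x" using x unfolding cyc_def by blast
  then have n: "0 < n \<and> (f ^^ n) x = x" unfolding n_def by (rule LeastI_ex)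
  have n_least: "i < n \<Longrightarrow> \<not> (0 < i \<and> (f ^^ i) x = x)" for i
    unfolding n_def by (rule not_less_Least)
  have per: "(f ^^ (n * j)) x = x" for j
    using n by (induction j) (auto simp: funpow_add_apply)
  have x_mod: "(f ^^ (l mod n)) x = (f ^^ l) x" for l
    using per[of "l div n"] funpow_add_apply[of "l mod n" "n * (l div n)" f x] by simp
  have n_dvd_x: "n dvd l" if "(f ^^ l) x = x" for l
  proof -
    have "(f ^^ (l mod n)) x = x" using x_mod[of l] that by simp
    moreover have "l mod n < n" using n by simp
    ultimately have "\<not> 0 < l mod n" using n_least[of "l mod n"] by metis
    then show ?thesis by auto
  qed
  have n_dvd: "n dvd l" if z: "z \<in> V" "(f ^^ l) z = z" for z l
  proof -
    obtain i where i: "(f ^^ i) x = z" using orbit z(1) by blast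
    have "i \<le> n * i" using n by simp
    then have j: "(f ^^ (n * i - i)) z = x"
      using per[of i] i funpow_add_apply[of "n * i - i" i f x] by simp
    then have "(f ^^ l) x = (f ^^ (n * i - i)) ((f ^^ l) z)"
      by (metis funpow_add_apply add.commute)
    then show "n dvd l" using n_dvd_x z(2) j by simp
  qed
  have xV: "x \<in> V" using x cyc_subset[of V f] by blast
  have "V = (\<lambda>i. (f ^^ i) x) ` {..<n}"
  proof
    show "V \<subseteq> (\<lambda>i. (f ^^ i) x) ` {..<n}"
    proof
      fix z assume "z \<in> V"
      then obtain l where "(f ^^ l) x = z" using orbit by blast
      then have "z = (f ^^ (l mod n)) x" using x_mod by simp
      moreover have "l mod n \<in> {..<n}" using n by simp
      ultimately show "z \<in> (\<lambda>i. (f ^^ i) x) ` {..<n}" by blast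
    qed
  qed (use funpow_in[OF fV xV] in auto)
  moreover have "inj_on (\<lambda>i. (f ^^ i) x) {..<n}"
  proof (rule linorder_inj_onI)
    fix i j assume ij: "i < j" "i \<in> {..<n}" "j \<in> {..<n}"
    show "(f ^^ i) x \<noteq> (f ^^ j) x"
    proof
      assume "(f ^^ i) x = (f ^^ j) x"
      then have "(f ^^ (j - i)) ((f ^^ i) x) = (f ^^ i) x"
        using ij(1) funpow_add_apply[of "j - i" i f x] by simp
      then have "n dvd j - i" using n_dvd funpow_in[OF fV xV] by blast
      then show False using ij by (auto dest: dvd_imp_le)
    qed
  qed auto
  ultimately have "card V = n" by (metis card_image card_lessThan)
  then show thesis using that n x_mod n_dvd by blast
qed

text \<open>Here \<open>l\<close> is the maximal level minus one: after \<open>l\<close> steps only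
  the states of maximal level are still off the cycles, and one step later they meet in their common
  root.\<close>

lemma unique_deepest_treeE:
  assumes "finite V" "f \<in> V \<rightarrow> V" "unique_deepest_tree V f"
  obtains l p where "p \<in> V" "(f ^^ l) p \<notin> cyc V f" "\<And>x. x \<in> V \<Longrightarrow> (f ^^ Suc l) x \<in> cyc V f"
    "\<And>x y. x \<in> V \<Longrightarrow> y \<in> V \<Longrightarrow> (f ^^ l) x \<notin> cyc V f \<Longrightarrow> (f ^^ l) y \<notin> cyc V f \<Longrightarrow>
        (f ^^ Suc l) x = (f ^^ Suc l) y"
proof -
  note iff = funpow_in_cyc_iff[OF assms(1,2)]
  obtain L r x0 where x0: "x0 \<in> V" "L < lev V f x0"
    and r: "\<And>x. x \<in> V \<Longrightarrow> L < lev V f x \<Longrightarrow> root V f x = r"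
    using assms(3) by (auto simp: unique_deepest_tree_def)
  define m where "m = Max (lev V f ` V)"
  have max: "lev V f x \<le> m" if "x \<in> V" for x unfolding m_def using that assms(1) by auto
  have "m \<in> lev V f ` V" unfolding m_def using x0 assms(1) by (intro Max_in) auto
  then obtain p where p: "p \<in> V" "lev V f p = m" by auto
  have Lm: "L < m" using x0 max by fastforce
  then obtain l where l: "m = Suc l" by (cases m) auto
  show thesis
  proof (rule that[of p l])
    fix x y assume xy: "x \<in> V" "y \<in> V" "(f ^^ l) x \<notin> cyc V f" "(f ^^ l) y \<notin> cyc V f"
    then have "lev V f x = Suc l" "lev V f y = Suc l" using iff max l
      by (metis le_SucE)+
    then show "(f ^^ Suc l) x = (f ^^ Suc l) y" using r xy Lm l unfolding root_def by metis
  qed (use p iff l max in \<open>auto simp del: funpow.simps\<close>)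
qed

section \<open>Redirecting one edge\<close>

lemma funpow_upd_eq:
  assumes "\<And>i. i < n \<Longrightarrow> (f ^^ i) x \<noteq> q"
  shows "((f(q := w)) ^^ n) x = (f ^^ n) x"
  using assms by (induction n) auto

lemma funpow_upd_eq':
  assumes "\<And>i. i < n \<Longrightarrow> ((f(q := w)) ^^ i) x \<noteq> q"
  shows "((f(q := w)) ^^ n) x = (f ^^ n) x"
  using assms by (induction n) auto

locale redirect =
  fixes V :: "'a set" and f :: "'a \<Rightarrow> 'a" and q w :: 'a
  assumes fin: "finite V" and fV: "f \<in> V \<rightarrow> V" and qV: "q \<in> V" and wV: "w \<in> V"
begin

abbreviation f' :: "'a \<Rightarrow> 'a" where "f' \<equiv> f(q := w)"

lemma f'V: "f' \<in> V \<rightarrow> V" using fV wV by auto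

lemmas iff = funpow_in_cyc_iff[OF fin fV]
lemmas iff' = funpow_in_cyc_iff[OF fin f'V]

context
  fixes x
  assumes avoid: "\<And>n. (f ^^ n) x \<noteq> q" and xV: "x \<in> V"
begin

lemma avoid_funpow: "(f' ^^ n) x = (f ^^ n) x"
  using avoid by (intro funpow_upd_eq)

lemma avoid_cyc_iff: "(f ^^ n) x \<in> cyc V f' \<longleftrightarrow> (f ^^ n) x \<in> cyc V f"
proof -
  have "(f' ^^ m) ((f ^^ n) x) = (f ^^ m) ((f ^^ n) x)" for m
    using avoid by (intro funpow_upd_eq) (metis funpow_add_apply)
  then show ?thesis by (auto simp: cyc_def)
qed

lemma avoid_lev: "lev V f' x = lev V f x"
  by (simp add: lev_def avoid_funpow avoid_cyc_iff)

end

text \<open>As \<open>w\<close> never leads back to \<open>q\<close>, the new edge lies on no cycle: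
  everything up to \<open>q\<close> is off the cycles, and from \<open>w\<close> on nothing has
  changed.\<close>

lemma lev_through_edge:
  assumes wq: "\<And>n. (f ^^ n) w \<noteq> q" and x: "x \<in> V" "(f ^^ j) x = q" "\<And>i. i < j \<Longrightarrow> (f ^^ i) x \<noteq> q"
  shows "lev V f' x = Suc j + lev V f w" "root V f' x = root V f w"
proof -
  have q: "(f' ^^ j) x = q" using funpow_upd_eq[of j f x q w] x by simp
  have w: "(f' ^^ (n + Suc j)) x = (f ^^ n) w" for n
  proof -
    have "(f' ^^ Suc j) x = w" using q by simp
    then show ?thesis using avoid_funpow[OF wq wV] by (metis funpow_add_apply)
  qed
  have nq: "q \<notin> cyc V f'"
  proof
    assume "q \<in> cyc V f'"
    then obtain m where m: "m > 0" "(f' ^^ m) q = q" by (auto simp: cyc_def)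
    then have "(f' ^^ (m - 1)) w = q"
      by (metis Suc_pred' diff_Suc_1 fun_upd_same funpow_Suc_right o_apply)
    then show False using avoid_funpow[OF wq wV] wq by metis
  qed
  then have low: "(f' ^^ i) x \<notin> cyc V f'" if "i \<le> j" for i
    using q that cyc_funpow[OF f'V, of "(f' ^^ i) x" "j - i"] by (metis funpow_add_apply le_add_diff_inverse2)
  show l: "lev V f' x = Suc j + lev V f w"
  proof (rule lev_eqI[OF fin f'V x(1)])
    show "(f' ^^ (Suc j + lev V f w)) x \<in> cyc V f'"
      using w[of "lev V f w"] avoid_cyc_iff[OF wq wV] iff[OF wV] by (simp add: add.commute)
    fix i assume i: "i < Suc j + lev V f w"
    show "(f' ^^ i) x \<notin> cyc V f'"
    proof (cases "i \<le> j")
      case False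
      then obtain n where "i = n + Suc j" by (metis Suc_leI add.commute le_Suc_ex linorder_not_le)
      then show ?thesis using i w[of n] avoid_cyc_iff[OF wq wV] iff[OF wV] by auto
    qed (simp add: low)
  qed
  show "root V f' x = root V f w"
    unfolding root_def l using w[of "lev V f w"] by (metis add.commute)
qed

text \<open>A state whose path avoids \<open>q\<close> keeps its level, so every state deeper than
  \<open>L\<close> uses the new edge and inherits the root of \<open>w\<close>.\<close>

lemma unique_deepest_if_deeper:
  assumes wq: "\<And>n. (f ^^ n) w \<noteq> q" and le: "\<And>x. x \<in> V \<Longrightarrow> lev V f x \<le> L"
    and x: "x \<in> V" "L < lev V f' x"
  shows "unique_deepest_tree V f'"
  unfolding unique_deepest_tree_def
proof (intro exI conjI ballI impI)
  show "\<exists>x\<in>V. L < lev V f' x" using x by blast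
  fix y assume y: "y \<in> V" "L < lev V f' y"
  have "\<exists>n. (f ^^ n) y = q" using avoid_lev[of y] y le by (metis linorder_not_le)
  then obtain j where "(f ^^ j) y = q" "\<And>i. i < j \<Longrightarrow> (f ^^ i) y \<noteq> q"
    using exists_least_iff[of "\<lambda>n. (f ^^ n) y = q"] by blast
  then show "root V f' y = root V f w" using lev_through_edge[OF wq y(1)] by blast
qed

lemma cyc_grows:
  assumes "(f ^^ j) w = q" "q \<notin> cyc V f"
  shows "cyc V f \<subset> cyc V f'"
proof -
  obtain j where j: "(f ^^ j) w = q" "\<And>i. i < j \<Longrightarrow> (f ^^ i) w \<noteq> q"
    using exists_least_iff[of "\<lambda>n. (f ^^ n) w = q"] assms(1) by blast
  have "(f' ^^ Suc j) q = q"
    using funpow_upd_eq[of j f w q w] j by (simp add: funpow_swap1)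
  then have "q \<in> cyc V f'" using qV unfolding cyc_def by blast
  moreover have "x \<in> cyc V f'" if "x \<in> cyc V f" for x
  proof -
    have "x \<in> V" using that cyc_subset by fastforce
    moreover have "(f ^^ n) x \<noteq> q" for n using cyc_funpow[OF fV that] assms(2) by metis
    ultimately show ?thesis using avoid_cyc_iff[of x 0] that by simp
  qed
  ultimately show ?thesis using assms(2) by blast
qed

end

text \<open>Redirecting the edge of a cyclic state \<open>q\<close> to a state \<open>p\<close> hanging off the same cycle replaces
  the arc \<open>f q, \<dots>\<close> of length \<open>k\<close> of the cycle by the branch from \<open>p\<close> of length \<open>L\<close>.\<close>

locale redirect_cycle = redirect V f q p for V :: "'a set" and f q p +
  fixes L
  assumes le: "\<And>x. x \<in> V \<Longrightarrow> lev V f x \<le> L" and levp: "lev V f p = L"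
    and q_cyc: "q \<in> cyc V f" and p_to_q: "\<exists>j. (f ^^ j) p = q"
begin

abbreviation "r \<equiv> (f ^^ L) p"

text \<open>On the old cycle, \<open>k\<close> steps lead from \<open>f q\<close> to the point
  \<open>r\<close> where the branch of \<open>p\<close> enters, and \<open>m\<close> more steps lead
  to \<open>q\<close>. The arc \<open>B\<close> before \<open>r\<close> drops off the cycle.\<close>

definition "k = (LEAST n. (f ^^ n) (f q) = r)"
definition "m = (LEAST n. (f ^^ n) r = q)"
definition "B = (\<lambda>i. (f ^^ i) (f q)) ` {..<k}"

lemma r_cyc: "r \<in> cyc V f" using iff[OF wV] levp by simp

lemma before_r: "i < L \<Longrightarrow> (f ^^ i) p \<notin> cyc V f" using iff[OF wV] levp by simp

lemma ex_m: "\<exists>n. (f ^^ n) r = q"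
proof -
  obtain j where j: "(f ^^ j) p = q" using p_to_q by blast
  then have "L \<le> j" using before_r[of j] q_cyc by (metis not_le)
  then show ?thesis using j by (intro exI[of _ "j - L"]) (simp flip: funpow_add_apply)
qed

lemma m: "(f ^^ m) r = q" and m_least: "i < m \<Longrightarrow> (f ^^ i) r \<noteq> q"
  unfolding m_def using ex_m by (auto intro: LeastI_ex dest: not_less_Least)

lemma on_cycle:
  assumes "x \<in> cyc V f" "(f ^^ j) x = q"
  shows "\<exists>t. (f ^^ t) (f q) = x"
proof -
  obtain n where n: "n > 0" "(f ^^ n) x = x" using assms by (auto simp: cyc_def)
  have per: "(f ^^ (n * i)) x = x" for i
    using n(2) by (induction i) (auto simp: funpow_add_apply)
  \<comment> \<open>Going round \<open>Suc j\<close> times leaves room to subtract the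
    \<open>j\<close> steps to \<open>q\<close> and the one to \<open>f q\<close>.\<close>
  have "j < n * Suc j" using n(1) by (cases n) auto
  then obtain t where t: "n * Suc j = t + Suc j" by (metis Suc_leI add.commute le_Suc_ex)
  then have "(f ^^ t) (f q) = x" using per[of "Suc j"] assms(2) by (simp add: funpow_add_apply funpow_swap1)
  then show ?thesis by blast
qed

lemma k: "(f ^^ k) (f q) = r" and k_least: "i < k \<Longrightarrow> (f ^^ i) (f q) \<noteq> r"
  unfolding k_def using on_cycle[OF r_cyc m] by (auto intro: LeastI_ex dest: not_less_Least)

lemma fq_cycle: "(f ^^ i) (f q) \<in> cyc V f"
  using cyc_funpow[OF fV cyc_step[OF fV q_cyc]] .

text \<open>Otherwise \<open>f q\<close> would return to itself after \<open>Suc i\<close> steps,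
  and \<open>r\<close> would be met before step \<open>k\<close>.\<close>

lemma q_notin_B: "i < k \<Longrightarrow> (f ^^ i) (f q) \<noteq> q"
proof
  assume i: "i < k" "(f ^^ i) (f q) = q"
  then have "(f ^^ (Suc i)) (f q) = f q" by simp
  then have "(f ^^ (k - Suc i)) (f q) = r"
    using k i(1) funpow_add_apply[of "k - Suc i" "Suc i" f "f q"] by simp
  then show False using k_least[of "k - Suc i"] i by simp
qed

lemma split_cycle: "(f ^^ t) (f q) \<in> B \<union> (\<lambda>i. (f ^^ i) r) ` {..m}"
proof (induction t rule: less_induct)
  case (less t)
  show ?case
  proof (cases "t < k")
    case False
    have t: "(f ^^ t) (f q) = (f ^^ (t - k)) r"
      using False k funpow_add_apply[of "t - k" k f "f q"] by simp
    show ?thesis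
    proof (cases "t - k \<le> m")
      case False
      then obtain d where d: "t - k = Suc d + m" by (metis add.commute add_Suc_right le_Suc_ex not_less_eq_eq)
      then have "(f ^^ t) (f q) = (f ^^ d) (f q)"
        using t m by (simp add: funpow_add_apply funpow_swap1)
      then show ?thesis using less[of d] d by simp
    qed (use t in auto)
  qed (auto simp: B_def)
qed

lemma branch: "i \<le> L + m \<Longrightarrow> (f' ^^ i) p = (f ^^ i) p"
proof (rule funpow_upd_eq)
  fix j assume "i \<le> L + m" "j < i"
  show "(f ^^ j) p \<noteq> q"
  proof (cases "j < L")
    case True then show ?thesis using before_r q_cyc by metis
  next
    case False
    then show ?thesis using m_least[of "j - L"] \<open>j < i\<close> \<open>i \<le> L + m\<close>
      by (simp flip: funpow_add_apply)
  qed
qed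

lemma new_cycle: "(f' ^^ (L + m)) p = q" "(f' ^^ Suc (L + m)) p = p"
proof -
  show "(f' ^^ (L + m)) p = q"
    using branch[of "L + m"] m by (metis add.commute funpow_add_apply order_refl)
  then show "(f' ^^ Suc (L + m)) p = p" by simp
qed

lemma p_cyc': "p \<in> cyc V f'"
  using new_cycle(2) wV unfolding cyc_def by blast

lemma q_cyc': "q \<in> cyc V f'"
  using cyc_funpow[OF f'V p_cyc'] new_cycle(1) by metis

lemma new_cycle_elem: "(f' ^^ n) p \<in> (\<lambda>i. (f ^^ i) p) ` {..L + m}"
proof (induction n)
  case 0
  show ?case by (auto intro!: rev_image_eqI[of 0])
next
  case (Suc n)
  then obtain i where i: "i \<le> L + m" "(f' ^^ n) p = (f ^^ i) p" by blast
  show ?case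
  proof (cases "i = L + m")
    case True
    then have "(f' ^^ n) p = (f' ^^ (L + m)) p" using i branch[OF i(1)] by simp
    then have "(f' ^^ Suc n) p = p" using new_cycle(2) by (simp only: funpow_Suc_apply)
    then show ?thesis by (metis atMost_iff funpow_0 image_eqI le0)
  next
    case False
    have "(f' ^^ n) p = (f' ^^ i) p" using i branch[of i] by simp
    then have "(f' ^^ Suc n) p = (f' ^^ Suc i) p" by (simp only: funpow_Suc_apply)
    also have "\<dots> = (f ^^ Suc i) p" using i False by (intro branch) simp
    finally have "(f' ^^ Suc n) p = (f ^^ Suc i) p" .
    moreover have "Suc i \<le> L + m" using i False by simp
    ultimately show ?thesis by blast
  qed
qed

lemma branch_cyc': "i \<le> L + m \<Longrightarrow> (f ^^ i) p \<in> cyc V f'"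
  using branch cyc_funpow[OF f'V p_cyc'] by metis

lemma arc_cyc': "i \<le> m \<Longrightarrow> (f ^^ i) r \<in> cyc V f'"
  using branch_cyc'[of "i + L"] by (simp add: funpow_add_apply)

lemma r_cyc': "r \<in> cyc V f'" using arc_cyc'[of 0] by simp

lemma B_funpow': "i \<le> k \<Longrightarrow> (f' ^^ i) (f q) = (f ^^ i) (f q)"
  using q_notin_B by (intro funpow_upd_eq) auto

text \<open>Such a state leads to \<open>r\<close>, so it would lie on the new cycle; being cyclic
  for \<open>f\<close>, it would lie on the arc from \<open>r\<close> to \<open>q\<close>. If it
  meets \<open>q\<close> before \<open>r\<close>, this contradicts \<open>q_notin_B\<close>;
  otherwise \<open>r\<close> reaches \<open>q\<close> in fewer than \<open>m\<close> steps.\<close>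

lemma B_not_cyc':
  assumes "i < k" shows "(f ^^ i) (f q) \<notin> cyc V f'"
proof
  let ?b = "(f ^^ i) (f q)"
  assume cy: "?b \<in> cyc V f'"
  have "(f' ^^ (k - i)) ?b = r"
    using B_funpow'[of k] B_funpow'[of i] assms k funpow_add_apply[of "k - i" i f' "f q"] by simp
  moreover obtain n where n: "n > 0" "(f' ^^ n) ?b = ?b" using cy by (auto simp: cyc_def)
  have per: "(f' ^^ (n * j)) ?b = ?b" for j
    using n(2) by (induction j) (auto simp: funpow_add_apply)
  have "k - i \<le> n * (k - i)" using n(1) by simp
  ultimately have "(f' ^^ (n * (k - i) - (k - i))) r = ?b"
    using per[of "k - i"] funpow_add_apply[of "n * (k - i) - (k - i)" "k - i" f' ?b] by simp
  then have "(f' ^^ (n * (k - i) - (k - i) + L)) p = ?b"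
    using branch[of L] by (simp add: funpow_add_apply)
  then obtain j where j: "j \<le> L + m" "?b = (f ^^ j) p" using new_cycle_elem by (metis (no_types, lifting) atMost_iff imageE)
  have "L \<le> j" using j before_r[of j] fq_cycle[of i] by (metis not_le)
  define i' where "i' = j - L"
  have i': "i' \<le> m" "?b = (f ^^ i') r"
    using j \<open>L \<le> j\<close> unfolding i'_def by (simp_all flip: funpow_add_apply)
  have toq: "(f ^^ (m - i')) ?b = q"
    using i' m funpow_add_apply[of "m - i'" i' f r] by simp
  have tor: "(f ^^ (k - i)) ?b = r"
    using assms k funpow_add_apply[of "k - i" i f "f q"] by simp
  show False
  proof (cases "m - i' < k - i")
    case True
    then have "m - i' + i < k" by linarith
    then show False using toq q_notin_B[of "m - i' + i"] by (simp add: funpow_add_apply)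
  next
    case False
    then have "m - i' - (k - i) + (k - i) = m - i'" by simp
    then have "(f ^^ (m - i' - (k - i))) r = q"
      using toq tor funpow_add_apply[of "m - i' - (k - i)" "k - i" f ?b] by simp
    moreover have "m - i' - (k - i) < m" using assms False by linarith
    ultimately show False using m_least by blast
  qed
qed

lemma cyc_minus_B: "cyc V f - B \<subseteq> cyc V f'"
proof
  fix x assume x: "x \<in> cyc V f - B"
  then have xV: "x \<in> V" using cyc_subset by fastforce
  show "x \<in> cyc V f'"
  proof (cases "\<exists>j. (f ^^ j) x = q")
    case True
    then obtain t where "(f ^^ t) (f q) = x" using on_cycle x by blast
    then show ?thesis using split_cycle[of t] x arc_cyc' by auto
  next
    case False
    then show ?thesis using avoid_cyc_iff[of x 0] xV x by simp
  qed
qed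

text \<open>The \<open>L\<close> states of the branch become cyclic, and at most the
  \<open>k\<close> states of \<open>B\<close> are lost.\<close>

lemma card_cyc': "card (cyc V f) + L \<le> card (cyc V f') + k"
proof -
  let ?A = "(\<lambda>i. (f ^^ i) p) ` {..<L}"
  have fin_cyc: "finite (cyc V g)" for g using fin cyc_subset finite_subset by metis
  have "inj_on (\<lambda>i. (f ^^ i) p) {..<L}"
  proof (rule linorder_inj_onI)
    fix i j assume "i < j" "i \<in> {..<L}" "j \<in> {..<L}"
    then show "(f ^^ i) p \<noteq> (f ^^ j) p" using funpow_collision_cyc[OF fV wV] before_r by blast
  qed auto
  then have A: "card ?A = L" by (simp add: card_image)
  have Bc: "card B \<le> k" unfolding B_def using card_image_le[of "{..<k}"] by fastforce
  have disj: "?A \<inter> (cyc V f - B) = {}" using before_r by auto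
  have "card (cyc V f) - k \<le> card (cyc V f - B)"
    using diff_card_le_card_Diff[of B "cyc V f"] Bc by (simp add: B_def)
  moreover have "L + card (cyc V f - B) = card (?A \<union> (cyc V f - B))"
    using A disj fin_cyc by (subst card_Un_disjoint) auto
  moreover have "\<dots> \<le> card (cyc V f')"
    using cyc_minus_B branch_cyc' fin_cyc by (intro card_mono) auto
  ultimately show ?thesis by linarith
qed

lemma lev_fq: "lev V f' (f q) = k"
proof (rule lev_eqI[OF fin f'V])
  show "f q \<in> V" using fV qV by auto
  show "(f' ^^ k) (f q) \<in> cyc V f'" using B_funpow'[of k] k r_cyc' by simp
  show "(f' ^^ i) (f q) \<notin> cyc V f'" if "i < k" for i
    using B_funpow'[of i] B_not_cyc'[of i] that by simp
qed

text \<open>On the path of a state deeper than \<open>L\<close>, the last state off the cycles of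
  \<open>f'\<close> was cyclic for \<open>f\<close>, so it belongs to \<open>B\<close>; and
  \<open>B\<close> enters a cycle of \<open>f'\<close> only at its end, in \<open>r\<close>.\<close>

lemma deep_root:
  assumes x: "x \<in> V" "L < lev V f' x"
  shows "root V f' x = r"
proof -
  obtain n where n: "lev V f' x = Suc n" using x by (cases "lev V f' x") auto
  let ?y = "(f' ^^ n) x"
  have nc: "i \<le> n \<Longrightarrow> (f' ^^ i) x \<notin> cyc V f'" for i using iff'[OF x(1)] n by simp
  have nq: "(f' ^^ i) x \<noteq> q" if "i \<le> n" for i using nc[OF that] q_cyc' by metis
  have y: "?y = (f ^^ n) x" using nq by (intro funpow_upd_eq') auto
  have "lev V f x \<le> n" using le[OF x(1)] x n by simp
  then have "?y \<in> cyc V f" using y iff[OF x(1)] by simp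
  then have "?y \<in> B" using cyc_minus_B nc[of n] by blast
  then obtain i where i: "i < k" "?y = (f ^^ i) (f q)" by (auto simp: B_def)
  have fy: "(f' ^^ Suc n) x = (f ^^ Suc i) (f q)" using nq[of n] i by simp
  moreover have "(f' ^^ Suc n) x \<in> cyc V f'" using iff'[OF x(1)] n by (metis order_refl)
  ultimately have "Suc i = k" using B_not_cyc'[of "Suc i"] i by (metis Suc_lessI)
  then show ?thesis unfolding root_def n using fy k by simp
qed

lemma unique_deepest_if_deeper': "x \<in> V \<Longrightarrow> L < lev V f' x \<Longrightarrow> unique_deepest_tree V f'"
  unfolding unique_deepest_tree_def using deep_root by blast

end

section \<open>Choosing one edge at every state\<close>

locale succ_graph =
  fixes V :: "'a set" and E :: "'a \<Rightarrow> 'a set"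
  assumes fin: "finite V" and EV: "\<And>x. x \<in> V \<Longrightarrow> E x \<subseteq> V" and E_ne: "\<And>x. x \<in> V \<Longrightarrow> E x \<noteq> {}"
    and in_edge: "\<And>y. y \<in> V \<Longrightarrow> \<exists>x\<in>V. y \<in> E x"
begin

definition sel :: "('a \<Rightarrow> 'a) \<Rightarrow> bool" where
  "sel f \<longleftrightarrow> (\<forall>x\<in>V. f x \<in> E x)"

definition max_sel :: "('a \<Rightarrow> 'a) \<Rightarrow> bool" where
  "max_sel f \<longleftrightarrow> sel f \<and> (\<forall>g. sel g \<longrightarrow> card (cyc V g) \<le> card (cyc V f))"

lemma sel_funcset: "sel f \<Longrightarrow> f \<in> V \<rightarrow> V"
  using EV by (auto simp: sel_def)

lemma sel_upd: "sel f \<Longrightarrow> w \<in> E q \<Longrightarrow> sel (f(q := w))"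
  by (auto simp: sel_def)

lemma finite_cyc: "finite (cyc V f)"
  using fin cyc_subset finite_subset by metis

lemma redirectI: "sel f \<Longrightarrow> q \<in> V \<Longrightarrow> w \<in> E q \<Longrightarrow> redirect V f q w"
  using fin EV sel_funcset by unfold_locales auto

lemma ex_max_sel: "\<exists>f. max_sel f"
proof -
  have "\<exists>f. sel f" unfolding sel_def by (rule bchoice) (use E_ne in auto)
  moreover have "card (cyc V f) < Suc (card V)" for f using fin cyc_subset card_mono le_imp_less_Suc by metis
  ultimately show ?thesis
    using ex_has_greatest_nat[of sel _ "\<lambda>f. card (cyc V f)" "Suc (card V)"]
    unfolding max_sel_def by (metis less_imp_le)
qed

section \<open>Rigidity of maximal selections when no selection has a unique deepest tree\<close>

context
  assumes no_deep: "\<And>f. sel f \<Longrightarrow> \<not> unique_deepest_tree V f"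
begin

text \<open>Every other outcome is excluded: if \<open>p\<close> did not lead to \<open>q\<close>,
  then \<open>q\<close> would get level \<open>L + 1\<close> and the deeper states would form one
  tree; if \<open>q\<close> were not cyclic, the cycles would grow; \<open>k > L\<close> makes
  \<open>f q\<close> too deep; \<open>k < L\<close> gives more cyclic states.\<close>

lemma max_sel_redirect_cycle:
  assumes f: "max_sel f" and le: "\<And>x. x \<in> V \<Longrightarrow> lev V f x \<le> L" and p: "p \<in> V" "lev V f p = L"
    and L: "0 < L" and q: "q \<in> V" "p \<in> E q"
  shows "redirect_cycle V f q p L" "redirect_cycle.k f q p L = L" "max_sel (f(q := p))"
    "\<And>x. x \<in> V \<Longrightarrow> lev V (f(q := p)) x \<le> L"
proof -
  have sel: "sel f" using f by (simp add: max_sel_def)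
  interpret redirect V f q p using redirectI[OF sel q] .
  have sel': "sel f'" using sel_upd[OF sel q(2)] .
  have hit: "\<exists>j. (f ^^ j) p = q"
  proof (rule ccontr)
    assume a: "\<nexists>j. (f ^^ j) p = q"
    then have "lev V f' q = Suc 0 + lev V f p"
      by (intro lev_through_edge) (use q in auto)
    then have "unique_deepest_tree V f'"
      using unique_deepest_if_deeper[OF _ le, of q] a p q by auto
    then show False using no_deep sel' by blast
  qed
  have q_cyc: "q \<in> cyc V f"
  proof (rule ccontr)
    assume "q \<notin> cyc V f"
    then have "card (cyc V f) < card (cyc V f')"
      using hit cyc_grows finite_cyc by (metis psubset_card_mono)
    then show False using f sel' by (auto simp: max_sel_def not_le[symmetric])
  qed
  show rc: "redirect_cycle V f q p L" by unfold_locales (use le p q_cyc hit in auto)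
  interpret redirect_cycle V f q p L by (fact rc)
  show le': "\<And>x. x \<in> V \<Longrightarrow> lev V f' x \<le> L"
    using unique_deepest_if_deeper' no_deep sel' by (meson not_le)
  have "f q \<in> V" using fV qV by auto
  then have "k \<le> L" using le' lev_fq by force
  moreover have le: "card (cyc V f') \<le> card (cyc V f)" using f sel' by (auto simp: max_sel_def)
  ultimately show kL: "k = L" using card_cyc' by linarith
  have "card (cyc V f') = card (cyc V f)" using kL card_cyc' le by linarith
  then show "max_sel f'" using f sel' by (simp add: max_sel_def)
qed

text \<open>Redirecting the last state \<open>u\<close> before the cycle to another target
  \<open>v\<close> keeps the selection maximal and \<open>p\<close> at level \<open>L\<close>. The
  exchange of equal lengths puts the entry point \<open>L + 1\<close> steps after \<open>q\<close>
  for both selections, and the cycle of \<open>q\<close> is untouched, so \<open>v\<close> is the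
  old entry point.\<close>

lemma last_branch_edge_bunch:
  assumes f: "max_sel f" and le: "\<And>x. x \<in> V \<Longrightarrow> lev V f x \<le> L" and p: "p \<in> V" "lev V f p = L"
    and L: "0 < L"
  shows "E ((f ^^ (L - 1)) p) = {(f ^^ L) p}"
proof -
  obtain q where q: "q \<in> V" "p \<in> E q" using in_edge p by blast
  have sel: "sel f" using f by (simp add: max_sel_def)
  have fV: "f \<in> V \<rightarrow> V" using sel_funcset[OF sel] .
  interpret rc: redirect_cycle V f q p L using max_sel_redirect_cycle[OF f le p L q] by blast
  have rk: "(f ^^ Suc L) q = (f ^^ L) p"
    using rc.k max_sel_redirect_cycle(2)[OF f le p L q] by (simp add: funpow_swap1)
  define u where "u = (f ^^ (L - 1)) p"
  have uV: "u \<in> V" unfolding u_def using funpow_in[OF fV p(1)] .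
  have fu: "f u = (f ^^ L) p" using L unfolding u_def by (cases L) auto
  have levu: "lev V f u = 1" unfolding u_def using lev_funpow[OF fin fV p(1)] p L by simp
  have u_nc: "u \<notin> cyc V f" using levu lev_eq_0_iff[OF fin fV uV] by simp
  have "v = (f ^^ L) p" if v: "v \<in> E u" for v
  proof (rule ccontr)
    assume ne: "v \<noteq> (f ^^ L) p"
    interpret redirect V f u v using redirectI[OF sel uV v] .
    have sel': "sel f'" using sel_upd[OF sel v] .
    have avoid: "(f ^^ n) v \<noteq> u" for n
    proof
      assume "(f ^^ n) v = u"
      then have "card (cyc V f) < card (cyc V f')"
        using u_nc cyc_grows finite_cyc by (metis psubset_card_mono)
      then show False using f sel' by (auto simp: max_sel_def not_le[symmetric])
    qed
    have cyc_avoid: "(f ^^ n) x \<noteq> u" if "x \<in> cyc V f" for x n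
      using cyc_funpow[OF fV that] u_nc by metis
    have le': "lev V f' x \<le> L" if "x \<in> V" for x
      using unique_deepest_if_deeper[OF avoid le that] no_deep sel' not_le by blast
    have first: "(f ^^ i) p \<noteq> u" if "i < L - 1" for i
      using lev_funpow[OF fin fV p(1), of i] p(2) levu that by (metis diff_less_mono2 less_diff_conv less_irrefl
        One_nat_def diff_diff_cancel Suc_leI L add.commute plus_1_eq_Suc)
    \<comment> \<open>The branch of \<open>p\<close> now continues through \<open>v\<close>; since
      no level exceeds \<open>L\<close>, the state \<open>v\<close> must be cyclic.\<close>
    have levp: "lev V f' p = L + lev V f v" and rootp: "root V f' p = root V f v"
      using lev_through_edge[OF avoid p(1) u_def[symmetric] first] L by simp_all
    then have v0: "lev V f v = 0" using le'[OF p(1)] by simp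
    have "cyc V f \<subseteq> cyc V f'"
    proof
      fix x assume x: "x \<in> cyc V f"
      then have "x \<in> V" using cyc_subset by fastforce
      then show "x \<in> cyc V f'" using avoid_cyc_iff[OF cyc_avoid[OF x], of 0] x by simp
    qed
    then have "card (cyc V f) \<le> card (cyc V f')" using finite_cyc card_mono by metis
    then have max': "max_sel f'" using f sel' unfolding max_sel_def by (meson order_trans)
    have levp': "lev V f' p = L" using levp v0 by simp
    interpret rc': redirect_cycle V f' q p L
      using max_sel_redirect_cycle[OF max' le' p(1) levp' L q] by blast
    have "(f' ^^ Suc L) q = (f' ^^ L) p"
      using rc'.k max_sel_redirect_cycle(2)[OF max' le' p(1) levp' L q] by (simp add: funpow_swap1)
    moreover have "(f' ^^ Suc L) q = (f ^^ Suc L) q"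
      using cyc_avoid[OF rc.q_cyc] by (intro funpow_upd_eq)
    moreover have "(f' ^^ L) p = v" using rootp levp' v0 by (simp add: root_def)
    ultimately show False using rk ne by simp
  qed
  then show ?thesis using E_ne[OF uV] unfolding u_def by blast
qed

end

text \<open>Trahtman's argument: start from a selection with the largest number of cyclic states and
  redirect single edges.\<close>

theorem deep_tree_or_bunches:
  obtains (deep) f where "sel f" "unique_deepest_tree V f"
  | (bunch) x y r where "x \<in> V" "y \<in> V" "x \<noteq> y" "E x = {r}" "E y = {r}"
  | (cycles) f where "\<And>x. x \<in> V \<Longrightarrow> E x = {f x}" "cyc V f = V"
proof (cases "\<exists>f. sel f \<and> unique_deepest_tree V f")
  case True
  then show thesis using deep by blast
next
  case False
  then have nd: "\<And>f. sel f \<Longrightarrow> \<not> unique_deepest_tree V f" by blast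
  obtain f where f: "max_sel f" using ex_max_sel by blast
  have sel: "sel f" using f by (simp add: max_sel_def)
  have fV: "f \<in> V \<rightarrow> V" using sel_funcset[OF sel] .
  show thesis
  proof (cases "cyc V f = V")
    case True
    have lev0: "x \<in> V \<Longrightarrow> lev V f x = 0" for x using lev_eq_0_iff[OF fin fV] True by blast
    have "w = f x" if x: "x \<in> V" and w: "w \<in> E x" for x w
    proof (rule ccontr)
      assume ne: "w \<noteq> f x"
      interpret redirect V f x w using redirectI[OF sel x w] .
      have sel': "sel f'" using sel_upd[OF sel w] .
      have "unique_deepest_tree V f'"
      proof (cases "\<exists>j. (f ^^ j) w = x")
        case True
        \<comment> \<open>All levels are 0, so \<open>w\<close> is its own entry point. As
          \<open>w\<close> differs from \<open>f x\<close>, the dropped arc is nonempty and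
          \<open>f x\<close> leaves the cycles.\<close>
        interpret redirect_cycle V f x w 0
          by unfold_locales (use lev0 wV x \<open>cyc V f = V\<close> True in auto)
        have "k \<noteq> 0" using k ne by (metis funpow_0)
        then have "0 < lev V f' (f x)" using lev_fq by (metis neq0_conv)
        moreover have "f x \<in> V" using fV x by blast
        ultimately show ?thesis by (rule unique_deepest_if_deeper'[rotated])
      next
        case False
        then have "lev V f' x = Suc 0 + lev V f w"
          by (intro lev_through_edge) (use x in auto)
        then show ?thesis using unique_deepest_if_deeper[of 0 x] False lev0 x by auto
      qed
      then show False using nd sel' by blast
    qed
    then have "E x = {f x}" if "x \<in> V" for x using E_ne[OF that] that by blast
    then show thesis using cycles True by blast
  next
    case False
    define L where "L = Max (lev V f ` V)"
    have le: "x \<in> V \<Longrightarrow> lev V f x \<le> L" for x unfolding L_def using fin by simp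
    obtain x0 where x0: "x0 \<in> V" "x0 \<notin> cyc V f" using False cyc_subset[of V f] by blast
    have "L \<in> lev V f ` V" unfolding L_def using x0 fin by (intro Max_in) auto
    then obtain p where p: "p \<in> V" "lev V f p = L" by auto
    have L: "0 < L" using le[OF x0(1)] x0 lev_eq_0_iff[OF fin fV x0(1)] by simp
    obtain q where q: "q \<in> V" "p \<in> E q" using in_edge p by blast
    note rcs = max_sel_redirect_cycle[OF nd f le p L q]
    interpret redirect_cycle V f q p L using rcs(1) by blast
    have kL: "k = L" using rcs(2) by blast
    have fq: "f q \<in> V" "lev V f' (f q) = L" using fV qV lev_fq kL by auto
    \<comment> \<open>After the exchange the dropped arc is itself a deepest branch of a maximal
      selection. Thus both predecessors of \<open>r\<close>, on the arc and on the branch of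
      \<open>p\<close>, are bunches; only the first is cyclic for \<open>f\<close>.\<close>
    have "E ((f' ^^ (L - 1)) (f q)) = {(f' ^^ L) (f q)}"
      using last_branch_edge_bunch[OF nd rcs(3,4) fq L] by blast
    moreover have "(f' ^^ L) (f q) = r" using B_funpow'[of k] k kL by simp
    moreover have "(f' ^^ (L - 1)) (f q) = (f ^^ (L - 1)) (f q)" using B_funpow'[of "L - 1"] kL by simp
    ultimately have "E ((f ^^ (L - 1)) (f q)) = {r}" by simp
    moreover have "E ((f ^^ (L - 1)) p) = {r}" using last_branch_edge_bunch[OF nd f le p L] by blast
    moreover have "(f ^^ (L - 1)) (f q) \<in> cyc V f" using fq_cycle .
    moreover have "(f ^^ (L - 1)) p \<notin> cyc V f" using before_r[of "L - 1"] L by simp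
    ultimately show thesis using bunch funpow_in[OF fV] p(1) fq(1) by metis
  qed
qed

end

section \<open>Periodic automata\<close>

text \<open>An automaton whose states have positions in a cycle of length \<open>N\<close>, with \<open>D i\<close> letters at
  position \<open>i\<close>. Letters are arbitrary natural numbers, read modulo \<open>D i\<close>, so that every word can be
  read at every state. The last assumption says that \<open>N\<close> is the period of the underlying graph.\<close>

definition steps :: "'a set \<Rightarrow> ('a \<Rightarrow> nat \<Rightarrow> 'a) \<Rightarrow> ('a \<times> 'a) set" where
  "steps V \<delta> = {(x, \<delta> x k) | x k. x \<in> V}"

lemma add_mod_self_dvd: "(a + l) mod N = a mod N \<Longrightarrow> N dvd l" for a l N :: nat
  using mod_eq_dvd_iff_nat[of a "a + l" N] by simp

locale periodic_automaton =
  fixes V :: "'a set" and c :: "'a \<Rightarrow> nat" and N :: nat and D :: "nat \<Rightarrow> nat"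
    and \<delta> :: "'a \<Rightarrow> nat \<Rightarrow> 'a"
  assumes fin: "finite V"
    and c_less: "\<And>x. x \<in> V \<Longrightarrow> c x < N"
    and D_pos: "\<And>x. x \<in> V \<Longrightarrow> 0 < D (c x)"
    and closed: "\<And>x k. x \<in> V \<Longrightarrow> \<delta> x k \<in> V"
    and c_step: "\<And>x k. x \<in> V \<Longrightarrow> c (\<delta> x k) = Suc (c x) mod N"
    and letter_mod: "\<And>x k. x \<in> V \<Longrightarrow> \<delta> x (k mod D (c x)) = \<delta> x k"
    and strong: "\<And>x y. x \<in> V \<Longrightarrow> y \<in> V \<Longrightarrow> (x, y) \<in> (steps V \<delta>)\<^sup>*"
    and period: "\<And>n. (\<And>x l. x \<in> V \<Longrightarrow> (x, x) \<in> steps V \<delta> ^^ l \<Longrightarrow> n dvd l) \<Longrightarrow> n dvd N"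
begin

abbreviation run :: "'a \<Rightarrow> nat list \<Rightarrow> 'a" where "run \<equiv> foldl \<delta>"

definition stab :: "'a \<Rightarrow> 'a \<Rightarrow> bool" where
  "stab x y \<longleftrightarrow> (\<forall>u. \<exists>v. run x (u @ v) = run y (u @ v))"

lemma run_in: "x \<in> V \<Longrightarrow> run x u \<in> V"
  by (induction u arbitrary: x) (auto simp: closed)

lemma c_run: "x \<in> V \<Longrightarrow> c (run x u) = (c x + length u) mod N"
  by (induction u arbitrary: x) (auto simp: closed c_step c_less mod_simps)

lemma ex_run:
  assumes "x \<in> V" "y \<in> V"
  shows "\<exists>u. run x u = y"
  using strong[OF assms]
proof (induction rule: rtrancl_induct)
  case base
  show ?case by (auto intro: exI[of _ "[]"])
next
  case (step y z)
  then obtain u k where "run x u = y" "z = \<delta> y k" by (auto simp: steps_def)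
  then show ?case by (intro exI[of _ "u @ [k]"]) simp
qed

lemma stab_refl: "stab x x" by (simp add: stab_def)

lemma stab_sym: "stab x y \<Longrightarrow> stab y x" unfolding stab_def by metis

lemma stab_trans:
  assumes "stab x y" "stab y z"
  shows "stab x z"
  unfolding stab_def
proof
  fix u
  obtain v where "run x (u @ v) = run y (u @ v)" using assms(1) by (auto simp: stab_def)
  moreover obtain w where "run y ((u @ v) @ w) = run z ((u @ v) @ w)"
    using assms(2) unfolding stab_def by blast
  ultimately have "run x (u @ (v @ w)) = run z (u @ (v @ w))" by simp
  then show "\<exists>v. run x (u @ v) = run z (u @ v)" by blast
qed

lemma stab_step: "stab x y \<Longrightarrow> stab (\<delta> x k) (\<delta> y k)"
  unfolding stab_def
proof
  fix u assume "\<forall>u. \<exists>v. run x (u @ v) = run y (u @ v)"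
  then obtain v where "run x ((k # u) @ v) = run y ((k # u) @ v)" by blast
  then show "\<exists>v. run (\<delta> x k) (u @ v) = run (\<delta> y k) (u @ v)" by auto
qed

subsection \<open>Cliques and stable pairs\<close>

definition fiber :: "nat \<Rightarrow> 'a set" where "fiber i = {x \<in> V. c x = i}"

definition img :: "'a set \<Rightarrow> nat list \<Rightarrow> 'a set" where "img S u = (\<lambda>x. run x u) ` S"

definition rank :: nat where
  "rank = (LEAST r. \<exists>x\<in>V. \<exists>u. card (img (fiber (c x)) u) = r)"

definition clique :: "'a set \<Rightarrow> bool" where
  "clique F \<longleftrightarrow> card F = rank \<and> (\<exists>x\<in>V. \<exists>u. F = img (fiber (c x)) u)"

lemma finite_fiber: "finite (fiber i)"
  using fin by (simp add: fiber_def)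

lemma img_append: "img S (u @ v) = img (img S u) v"
  by (auto simp: img_def)

lemma img_mono: "S \<subseteq> T \<Longrightarrow> img S u \<subseteq> img T u"
  by (auto simp: img_def)

lemma img_fiber_subset: "x \<in> V \<Longrightarrow> img (fiber (c x)) u \<subseteq> fiber (c (run x u))"
  by (auto simp: img_def fiber_def run_in c_run)

lemma rank_le: "x \<in> V \<Longrightarrow> rank \<le> card (img (fiber (c x)) u)"
  unfolding rank_def by (rule Least_le) blast

text \<open>By strong connectivity some word moves the fiber of \<open>x\<close> into a fiber on
  which the minimum is attained.\<close>

lemma ex_rank:
  assumes "x \<in> V"
  shows "\<exists>u. card (img (fiber (c x)) u) = rank"
proof -
  have "\<exists>y\<in>V. \<exists>u. card (img (fiber (c y)) u) = rank"
    unfolding rank_def by (rule LeastI_ex) (use assms in blast)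
  then obtain y w where y: "y \<in> V" "card (img (fiber (c y)) w) = rank" by blast
  obtain u where u: "run x u = y" using ex_run assms y by blast
  have "img (fiber (c x)) (u @ w) \<subseteq> img (fiber (c y)) w"
    using img_mono[OF img_fiber_subset[OF assms, of u]] u by (simp add: img_append)
  then have "card (img (fiber (c x)) (u @ w)) \<le> rank"
    using y(2) finite_fiber by (metis card_mono finite_imageI img_def)
  then show ?thesis using rank_le[OF assms] by (meson le_antisym)
qed

lemma finite_clique: "clique F \<Longrightarrow> finite F"
  using finite_fiber by (auto simp: clique_def img_def)

lemma clique_fiber: "clique F \<Longrightarrow> \<exists>x\<in>V. F \<subseteq> fiber (c x)"
proof -
  assume "clique F"
  then obtain x u where x: "x \<in> V" "F = img (fiber (c x)) u" by (auto simp: clique_def)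
  then have "F \<subseteq> fiber (c (run x u))" using img_fiber_subset by blast
  then show ?thesis using run_in[OF x(1)] by blast
qed

text \<open>A clique is already an image of least size, so no word can identify two of its
  states.\<close>

lemma clique_img:
  assumes "clique F"
  shows "clique (img F u)" "inj_on (\<lambda>x. run x u) F"
proof -
  obtain x w where x: "x \<in> V" "F = img (fiber (c x)) w" using assms by (auto simp: clique_def)
  have "rank \<le> card (img F u)" using rank_le[OF x(1)] x(2) by (metis img_append)
  moreover have "card (img F u) \<le> card F" using card_image_le finite_clique[OF assms] unfolding img_def by blast
  ultimately have eq: "card (img F u) = card F" "card F = rank" using assms by (auto simp: clique_def)
  then show "clique (img F u)" using x unfolding clique_def by (metis img_append)
  show "inj_on (\<lambda>x. run x u) F" using eq(1) finite_clique[OF assms] unfolding img_def by (simp add: eq_card_imp_inj_on)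
qed

text \<open>Shrink the fiber of \<open>p\<close> to a clique, which contains the image of
  \<open>p\<close>, and lead that image back to \<open>p\<close>.\<close>

lemma ex_clique:
  assumes "p \<in> V"
  shows "\<exists>F. clique F \<and> p \<in> F"
proof -
  obtain u where u: "card (img (fiber (c p)) u) = rank" using ex_rank assms by blast
  then have F: "clique (img (fiber (c p)) u)" using assms by (auto simp: clique_def)
  have "p \<in> fiber (c p)" using assms by (simp add: fiber_def)
  then have q: "run p u \<in> img (fiber (c p)) u" by (auto simp: img_def)
  obtain w where "run (run p u) w = p" using ex_run run_in assms by blast
  then have "p \<in> img (img (fiber (c p)) u) w" using q by (force simp: img_def)
  then show ?thesis using clique_img(1)[OF F] by blast
qed

text \<open>If \<open>a\<close> and \<open>b\<close> could not be merged after reading \<open>u\<close>, the image of \<open>insert a (insert b S)\<close> under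
  \<open>u\<close> would be a set of more than \<open>rank\<close> states that no word can shrink.\<close>

lemma cliques_differ_once_stab:
  assumes A: "clique (insert a S)" and B: "clique (insert b S)"
    and ab: "a \<notin> S" "b \<notin> S" "c a = c b"
  shows "stab a b"
proof (rule ccontr)
  assume "\<not> stab a b"
  then obtain u where u: "\<And>v. run a (u @ v) \<noteq> run b (u @ v)" by (auto simp: stab_def)
  let ?T = "insert a (insert b S)"
  have ne: "a \<noteq> b" using u by blast
  obtain x where x: "x \<in> V" "insert a S \<subseteq> fiber (c x)" using clique_fiber[OF A] by blast
  have bV: "b \<in> V" using clique_fiber[OF B] by (auto simp: fiber_def)
  have T: "?T \<subseteq> fiber (c x)" using x ab(3) bV by (auto simp: fiber_def)
  have inj: "inj_on (\<lambda>x. run x (u @ v)) ?T" for v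
    using clique_img(2)[OF A, of "u @ v"] clique_img(2)[OF B, of "u @ v"] u[of v]
    by (auto simp del: foldl_append)
  obtain v where v: "card (img (fiber (c (run x u))) v) = rank" using ex_rank run_in x by blast
  have "img ?T (u @ v) \<subseteq> img (fiber (c (run x u))) v"
    using img_mono[OF img_mono[OF T]] img_mono[OF img_fiber_subset[OF x(1)]]
    unfolding img_append by (rule order_trans)
  then have "card (img ?T (u @ v)) \<le> rank"
    using v finite_fiber by (metis card_mono finite_imageI img_def)
  moreover have "card (img ?T (u @ v)) = card ?T" unfolding img_def using inj card_image by blast
  moreover have "card ?T = Suc (card (insert b S))"
    using ab ne finite_clique[OF B] by simp
  ultimately show False using B by (simp add: clique_def)
qed

lemma run_replicate: "run x (replicate n k) = ((\<lambda>x. \<delta> x k) ^^ n) x"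
  by (induction n arbitrary: x) (simp_all add: funpow_Suc_right del: funpow.simps(2))

section \<open>Stable pairs from a deepest tree and from bunches, and the case of a pure
  cycle\<close>

text \<open>Letter 0 follows the selection. In a clique through the deepest state \<open>p\<close>,
  only \<open>p\<close> is still off the cycles after \<open>l\<close> letters, since another such
  state would merge with it at the next letter. A common period \<open>m\<close> of the cyclic
  states then fixes all the others and moves \<open>a\<close> to a cyclic state
  \<open>b\<close>.\<close>

theorem unique_deepest_tree_stab:
  assumes f: "\<And>x. x \<in> V \<Longrightarrow> \<delta> x 0 = f x" and deep: "unique_deepest_tree V f"
  shows "\<exists>x\<in>V. \<exists>y\<in>V. x \<noteq> y \<and> c x = c y \<and> stab x y"
proof -
  have fV: "f \<in> V \<rightarrow> V" using f closed by (metis Pi_I)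
  have run0: "run x (replicate n 0) = (f ^^ n) x" if "x \<in> V" for x n
    unfolding run_replicate using f funpow_in[OF fV that] by (induction n) auto
  obtain l p where p: "p \<in> V" "(f ^^ l) p \<notin> cyc V f"
    and cyc: "\<And>x. x \<in> V \<Longrightarrow> (f ^^ Suc l) x \<in> cyc V f"
    and merge: "\<And>x y. x \<in> V \<Longrightarrow> y \<in> V \<Longrightarrow> (f ^^ l) x \<notin> cyc V f \<Longrightarrow> (f ^^ l) y \<notin> cyc V f \<Longrightarrow>
        (f ^^ Suc l) x = (f ^^ Suc l) y"
    using unique_deepest_treeE[OF fin fV deep] by metis
  obtain F where F: "clique F" "p \<in> F" using ex_clique p by blast
  have FV: "F \<subseteq> V" using clique_fiber[OF F(1)] by (auto simp: fiber_def)
  define a where "a = (f ^^ l) p"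
  define S where "S = (f ^^ l) ` (F - {p})"
  have aV: "a \<in> V" unfolding a_def using funpow_in[OF fV p(1)] .
  have S_cyc: "S \<subseteq> cyc V f"
  proof
    fix s assume "s \<in> S"
    then obtain y where y: "y \<in> F" "y \<noteq> p" "s = (f ^^ l) y" by (auto simp: S_def)
    have "inj_on (\<lambda>x. run x (replicate (Suc l) 0)) F" by (rule clique_img(2)[OF F(1)])
    then have "(f ^^ Suc l) y \<noteq> (f ^^ Suc l) p"
      using y F FV run0[of y "Suc l"] run0[of p "Suc l"] by (metis inj_onD subsetD)
    then show "s \<in> cyc V f" using merge y p FV by blast
  qed
  obtain m where m: "0 < m" "\<And>z. z \<in> cyc V f \<Longrightarrow> (f ^^ m) z = z"
    using cyc_common_period[OF fin, of f] by blast
  define b where "b = (f ^^ m) a"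
  have "F = insert p (F - {p})" using F by blast
  then have "insert a S = (f ^^ l) ` F" unfolding a_def S_def by blast
  also have "\<dots> = img F (replicate l 0)" unfolding img_def using run0 FV by (intro image_cong) auto
  finally have A: "clique (insert a S)" using clique_img(1)[OF F(1)] by simp
  have fa: "f a \<in> cyc V f" using cyc[OF p(1)] by (simp add: a_def)
  obtain m' where m': "m = Suc m'" using m(1) by (cases m) auto
  have b_cyc: "b \<in> cyc V f"
    using cyc_funpow[OF fV fa, of m'] by (simp add: b_def m' funpow_swap1)
  have SV: "S \<subseteq> V" using S_cyc cyc_subset[of V f] by blast
  have "img (insert a S) (replicate m 0) = (f ^^ m) ` insert a S"
    unfolding img_def using run0 SV aV by (intro image_cong) auto
  also have "\<dots> = insert b S"
  proof -
    have "(f ^^ m) ` S = S" using S_cyc m(2) by force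
    then show ?thesis by (simp add: b_def)
  qed
  finally have B: "clique (insert b S)" using clique_img(1)[OF A, of "replicate m 0"] by simp
  have a_nc: "a \<notin> cyc V f" using p by (simp add: a_def)
  then have "a \<notin> S" using S_cyc by blast
  moreover have "b \<notin> S"
  proof
    assume "b \<in> S"
    then have "insert b S = S" by blast
    then have "card (insert a S) = card S" using A B by (simp add: clique_def)
    then show False using \<open>a \<notin> S\<close> finite_clique[OF A] by simp
  qed
  moreover have "c a = c b"
  proof -
    \<comment> \<open>The cyclic state \<open>f a\<close> returns to itself after \<open>m\<close>
      steps, so \<open>N\<close> divides \<open>m\<close>, and \<open>m\<close> steps preserve the
      position of \<open>a\<close>.\<close>
    have "c (f b) = (c (f a) + m) mod N"
      using c_run[of "f a" "replicate m 0"] run0[of "f a" m] fa cyc_subset[of V f]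
      by (auto simp: b_def funpow_swap1)
    moreover have "f b = f a" using m(2)[OF fa] by (simp add: b_def funpow_swap1)
    ultimately have "(c (f a) + m) mod N = c (f a) mod N"
      using c_less[of "f a"] fa cyc_subset[of V f] by auto
    then have "N dvd m" by (rule add_mod_self_dvd)
    then show ?thesis using c_run[OF aV, of "replicate m 0"] run0[OF aV, of m] c_less[OF aV]
      by (auto simp: b_def)
  qed
  ultimately have "stab a b" by (intro cliques_differ_once_stab[OF A B])
  moreover have "a \<noteq> b" using a_nc b_cyc by blast
  moreover have "b \<in> V" using b_cyc cyc_subset[of V f] by blast
  ultimately show ?thesis using aV \<open>c a = c b\<close> by blast
qed

lemma bunches_stab:
  assumes "x \<in> V" "y \<in> V" "range (\<delta> x) = {r}" "range (\<delta> y) = {r}"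
  shows "c x = c y" "stab x y"
proof -
  have eq: "\<delta> x k = r" "\<delta> y k = r" for k using assms by blast+
  have "Suc (c x) mod N = Suc (c y) mod N" using c_step[of _ 0] assms eq by metis
  then show "c x = c y" using c_less[OF assms(1)] c_less[OF assms(2)]
    by (auto simp: mod_Suc split: if_splits)
  have "run x (u @ [0]) = run y (u @ [0])" for u
    using eq by (cases u) auto
  then show "stab x y" unfolding stab_def by blast
qed

text \<open>The states form one cycle, whose length \<open>n\<close> divides \<open>N\<close> by the
  assumption \<open>period\<close>; states at the same position are a multiple of \<open>N\<close>
  apart.\<close>

lemma cycle_fibers_trivial:
  assumes f: "\<And>x k. x \<in> V \<Longrightarrow> \<delta> x k = f x" and cyc: "cyc V f = V"
    and xy: "x \<in> V" "y \<in> V" "c x = c y"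
  shows "x = y"
proof -
  have fV: "f \<in> V \<rightarrow> V" using f closed by (metis Pi_I)
  have run: "run x u = (f ^^ length u) x" if "x \<in> V" for x u
    using that
  proof (induction u rule: rev_induct)
    case (snoc k u)
    then show ?case using f[OF run_in[of x u]] by simp
  qed simp
  have steps: "(z, z') \<in> steps V \<delta> ^^ l \<longleftrightarrow> z' = (f ^^ l) z" if "z \<in> V" for z z' l
  proof (induction l arbitrary: z')
    case (Suc l)
    then show ?case using f funpow_in[OF fV that, of l] by (auto simp: steps_def relcomp_unfold)
  qed auto
  have all: "\<exists>n. (f ^^ n) x = z" if "z \<in> V" for z using ex_run[OF xy(1) that] run[OF xy(1)] by metis
  have "x \<in> cyc V f" using cyc xy(1) by simp
  then obtain n where n: "\<And>l. (f ^^ (l mod n)) x = (f ^^ l) x"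
    and n_dvd: "\<And>z l. z \<in> V \<Longrightarrow> (f ^^ l) z = z \<Longrightarrow> n dvd l"
    using single_orbit[OF fV _ all] by metis
  have "n dvd N"
    by (rule period) (use n_dvd steps in metis)
  obtain l where l: "(f ^^ l) x = y" using all xy(2) by blast
  then have "(c x + l) mod N = c x mod N"
    using c_run[OF xy(1), of "replicate l 0"] run[OF xy(1), of "replicate l 0"] xy c_less[OF xy(1)] by simp
  then have "N dvd l" by (rule add_mod_self_dvd)
  then have "n dvd l" using \<open>n dvd N\<close> dvd_trans by blast
  then show "x = y" using n[of l] l by simp
qed

end

section \<open>Recolouring\<close>

text \<open>Reducing \<open>k\<close> before applying \<open>\<rho>\<close> makes the result depend
  on letters modulo \<open>d x\<close>, as \<open>letter_mod\<close> demands.\<close>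

definition recolor :: "('a \<Rightarrow> nat) \<Rightarrow> ('a \<Rightarrow> nat \<Rightarrow> nat) \<Rightarrow> ('a \<Rightarrow> nat \<Rightarrow> 'a) \<Rightarrow> 'a \<Rightarrow> nat \<Rightarrow> 'a" where
  "recolor d \<rho> \<delta> x k = \<delta> x (\<rho> x (k mod d x))"

context periodic_automaton
begin

abbreviation d :: "'a \<Rightarrow> nat" where "d x \<equiv> D (c x)"

definition recoloring :: "('a \<Rightarrow> nat \<Rightarrow> nat) \<Rightarrow> bool" where
  "recoloring \<rho> \<longleftrightarrow> (\<forall>x\<in>V. bij_betw (\<rho> x) {..<d x} {..<d x})"

lemma recoloring_surj:
  assumes "recoloring \<rho>" "x \<in> V" "k < d x"
  obtains j where "j < d x" "\<rho> x j = k"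
proof -
  have "\<rho> x ` {..<d x} = {..<d x}" using assms by (auto simp: recoloring_def bij_betw_def)
  then have "k \<in> \<rho> x ` {..<d x}" using assms by simp
  then show thesis using that by auto
qed

lemma steps_recolor:
  assumes "recoloring \<rho>"
  shows "steps V (recolor d \<rho> \<delta>) = steps V \<delta>"
proof -
  have "\<exists>j. \<delta> x k = recolor d \<rho> \<delta> x j" if x: "x \<in> V" for x k
  proof -
    obtain j where "j < d x" "\<rho> x j = k mod d x"
      using recoloring_surj[OF assms x, of "k mod d x"] D_pos[OF x] by auto
    then have "recolor d \<rho> \<delta> x j = \<delta> x k" using letter_mod[OF x] by (simp add: recolor_def)
    then show ?thesis by metis
  qed
  then show ?thesis unfolding steps_def by (auto simp: recolor_def)
qed

lemma recolor_automaton: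
  assumes "recoloring \<rho>"
  shows "periodic_automaton V c N D (recolor d \<rho> \<delta>)"
  using fin c_less D_pos closed c_step strong period
  by unfold_locales (auto simp: steps_recolor[OF assms] simp: recolor_def)

lemma recoloring_selects:
  assumes "\<And>x. x \<in> V \<Longrightarrow> f x \<in> range (\<delta> x)"
  shows "\<exists>\<rho>. recoloring \<rho> \<and> (\<forall>x\<in>V. recolor d \<rho> \<delta> x 0 = f x)"
proof -
  have "\<exists>j<d x. \<delta> x j = f x" if x: "x \<in> V" for x
  proof -
    obtain k where "f x = \<delta> x k" using assms[OF x] by blast
    then show ?thesis using letter_mod[OF x, of k] D_pos[OF x] by (intro exI[of _ "k mod d x"]) simp
  qed
  then obtain j where j: "\<And>x. x \<in> V \<Longrightarrow> j x < d x \<and> \<delta> x (j x) = f x" by metis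
  \<comment> \<open>The transposition of \<open>0\<close> and \<open>j x\<close>, which is its own
    inverse.\<close>
  define \<rho> where "\<rho> x i = (if i = 0 then j x else if i = j x then 0 else i)" for x i
  have "bij_betw (\<rho> x) {..<d x} {..<d x}" if "x \<in> V" for x
    by (rule bij_betw_byWitness[of _ "\<rho> x"]) (use j[OF that] in \<open>auto simp: \<rho>_def\<close>)
  then have "recoloring \<rho>" by (simp add: recoloring_def)
  moreover have "recolor d \<rho> \<delta> x 0 = f x" if "x \<in> V" for x
    using j[OF that] by (simp add: recolor_def \<rho>_def)
  ultimately show ?thesis by blast
qed

lemma succ_graph: "succ_graph V (\<lambda>x. range (\<delta> x))"
proof
  show "\<exists>x\<in>V. y \<in> range (\<delta> x)" if y: "y \<in> V" for y
    using strong[OF closed[OF y, of 0] y]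
  proof (cases rule: rtranclE)
    case base
    then show ?thesis using y by (metis rangeI)
  qed (auto simp: steps_def)
qed (use fin closed in auto)

lemma recoloring_id: "recoloring (\<lambda>x k. k)"
  by (simp add: recoloring_def bij_betw_def)

lemma recolor_id: "x \<in> V \<Longrightarrow> recolor d (\<lambda>x k. k) \<delta> x k = \<delta> x k"
  using letter_mod by (simp add: recolor_def)

theorem ex_recoloring_stab_pair:
  assumes "x \<in> V" "y \<in> V" "x \<noteq> y" "c x = c y"
  shows "\<exists>\<rho>. recoloring \<rho> \<and>
    (\<exists>x\<in>V. \<exists>y\<in>V. x \<noteq> y \<and> c x = c y \<and> periodic_automaton.stab (recolor d \<rho> \<delta>) x y)"
proof -
  interpret sg: succ_graph V "\<lambda>x. range (\<delta> x)" by (fact succ_graph)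
  show ?thesis
  proof (cases rule: sg.deep_tree_or_bunches)
    case (deep f)
    then obtain \<rho> where \<rho>: "recoloring \<rho>" "\<forall>x\<in>V. recolor d \<rho> \<delta> x 0 = f x"
      using recoloring_selects[of f] by (auto simp: sg.sel_def)
    interpret r: periodic_automaton V c N D "recolor d \<rho> \<delta>" by (rule recolor_automaton[OF \<rho>(1)])
    show ?thesis using r.unique_deepest_tree_stab[of f] \<rho> deep(2) by blast
  next
    case (bunch x y r)
    interpret r: periodic_automaton V c N D "recolor d (\<lambda>x k. k) \<delta>"
      by (rule recolor_automaton[OF recoloring_id])
    have "recolor d (\<lambda>x k. k) \<delta> x k = r" "recolor d (\<lambda>x k. k) \<delta> y k = r" for k
      using bunch recolor_id by auto
    then have "range (recolor d (\<lambda>x k. k) \<delta> x) = {r}" "range (recolor d (\<lambda>x k. k) \<delta> y) = {r}" by auto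
    then show ?thesis using r.bunches_stab[OF bunch(1,2)] bunch(1-3) recoloring_id by blast
  next
    case (cycles f)
    then have "\<delta> x k = f x" if "x \<in> V" for x k using that by blast
    then show ?thesis using cycle_fibers_trivial cycles(2) assms by blast
  qed
qed

subsection \<open>The quotient by the stability relation\<close>

text \<open>Classes are represented by states of \<open>V\<close>, so the quotient has the same type
  and keeps \<open>c\<close>, \<open>N\<close> and \<open>D\<close>, as the induction on the number
  of states requires.\<close>

definition rep :: "'a \<Rightarrow> 'a" where
  "rep x = (SOME y. y \<in> V \<and> c y = c x \<and> stab x y)"

lemma rep:
  assumes "x \<in> V"
  shows "rep x \<in> V" "c (rep x) = c x" "stab x (rep x)"
proof -
  have "rep x \<in> V \<and> c (rep x) = c x \<and> stab x (rep x)"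
    unfolding rep_def by (rule someI[of _ x]) (use assms stab_refl in simp)
  then show "rep x \<in> V" "c (rep x) = c x" "stab x (rep x)" by auto
qed

lemma rep_eq_iff:
  assumes "x \<in> V" "y \<in> V"
  shows "rep x = rep y \<longleftrightarrow> c x = c y \<and> stab x y"
proof
  assume "rep x = rep y"
  then show "c x = c y \<and> stab x y"
    using rep[OF assms(1)] rep[OF assms(2)] stab_sym stab_trans by metis
next
  assume a: "c x = c y \<and> stab x y"
  have "stab x z = stab y z" for z using a stab_sym stab_trans by blast
  then show "rep x = rep y" using a by (simp add: rep_def)
qed

lemma rep_step: "x \<in> V \<Longrightarrow> rep (\<delta> (rep x) k) = rep (\<delta> x k)"
  using rep[of x] rep_eq_iff[OF closed closed] by (simp add: c_step stab_step stab_sym)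

abbreviation quot :: "'a \<Rightarrow> nat \<Rightarrow> 'a" where "quot x k \<equiv> rep (\<delta> x k)"

lemma quotient_step: "(x, y) \<in> steps V \<delta> \<Longrightarrow> (rep x, rep y) \<in> steps (rep ` V) quot"
  unfolding steps_def using rep_step by fastforce

lemma quotient_relpow: "(x, y) \<in> steps V \<delta> ^^ l \<Longrightarrow> (rep x, rep y) \<in> steps (rep ` V) quot ^^ l"
  by (induction l arbitrary: y) (auto dest: quotient_step)

text \<open>Closed walks project to closed walks of the same length, so a common divisor of the
  cycle lengths of the quotient still divides \<open>N\<close>.\<close>

lemma quotient_automaton: "periodic_automaton (rep ` V) c N D quot"
proof
  show "(x, y) \<in> (steps (rep ` V) quot)\<^sup>*" if xy: "x \<in> rep ` V" "y \<in> rep ` V" for x y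
  proof -
    obtain x' y' where xy': "x' \<in> V" "y' \<in> V" "x = rep x'" "y = rep y'" using xy by blast
    then obtain l where "(x', y') \<in> steps V \<delta> ^^ l" using strong rtrancl_imp_relpow by metis
    then show ?thesis using quotient_relpow xy' relpow_imp_rtrancl by metis
  qed
  show "n dvd N" if "\<And>x l. x \<in> rep ` V \<Longrightarrow> (x, x) \<in> steps (rep ` V) quot ^^ l \<Longrightarrow> n dvd l" for n
    using period that quotient_relpow by blast
  show "quot x (k mod D (c x)) = quot x k" if "x \<in> rep ` V" for x k
  proof -
    have "x \<in> V" using that rep by auto
    then show ?thesis using letter_mod by simp
  qed
qed (use fin c_less D_pos closed c_step rep in auto)

lemma quotient_card:
  assumes "x \<in> V" "y \<in> V" "x \<noteq> y" "c x = c y" "stab x y"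
  shows "card (rep ` V) < card V"
proof -
  have "\<not> inj_on rep V" using assms rep_eq_iff by (meson inj_onD)
  then show ?thesis using card_image_le[OF fin] fin eq_card_imp_inj_on by (metis le_neq_implies_less)
qed

text \<open>A recolouring of the quotient, lifted along \<open>rep\<close>, treats stable states alike; hence it keeps
  stable pairs mergeable.\<close>

lemma lift_recoloring:
  assumes \<rho>: "periodic_automaton.recoloring (rep ` V) c D \<rho>"
  assumes sync: "\<And>x y. x \<in> rep ` V \<Longrightarrow> y \<in> rep ` V \<Longrightarrow> c x = c y \<Longrightarrow>
    periodic_automaton.stab (recolor d \<rho> quot) x y"
  shows "recoloring (\<lambda>x. \<rho> (rep x))"
    "\<And>x y. x \<in> V \<Longrightarrow> y \<in> V \<Longrightarrow> c x = c y \<Longrightarrow>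
       periodic_automaton.stab (recolor d (\<lambda>x. \<rho> (rep x)) \<delta>) x y"
proof -
  interpret q: periodic_automaton "rep ` V" c N D quot by (rule quotient_automaton)
  show rec: "recoloring (\<lambda>x. \<rho> (rep x))"
    using \<rho> rep unfolding q.recoloring_def recoloring_def by auto
  let ?\<delta> = "recolor d (\<lambda>x. \<rho> (rep x)) \<delta>"
  let ?q = "recolor d \<rho> quot"
  interpret r: periodic_automaton V c N D ?\<delta> by (rule recolor_automaton[OF rec])
  interpret qr: periodic_automaton "rep ` V" c N D ?q by (rule q.recolor_automaton[OF \<rho>])
  have proj: "rep (foldl ?\<delta> x u) = foldl ?q (rep x) u" if "x \<in> V" for x u
    using that
  proof (induction u arbitrary: x)
    case (Cons k u)
    have "rep (?\<delta> x k) = ?q (rep x) k"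
      using Cons.prems rep rep_step by (simp add: recolor_def)
    then show ?case using Cons.IH[OF r.closed[OF Cons.prems]] by simp
  qed simp
  \<comment> \<open>Two states with the same representative use the same permutation of letters and
    stay so related, hence a word can be recoded for both at once.\<close>
  have transl: "\<exists>w. foldl ?\<delta> x w = run x u \<and> foldl ?\<delta> y w = run y u"
    if "x \<in> V" "y \<in> V" "rep x = rep y" for x y u
    using that
  proof (induction u arbitrary: x y)
    case Nil
    show ?case by (rule exI[of _ "[]"]) simp
  next
    case (Cons k u)
    have cs: "c x = c y" "stab x y" using Cons.prems rep_eq_iff by auto
    obtain j where j: "j < d x" "\<rho> (rep x) j = k mod d x"
      using recoloring_surj[OF rec Cons.prems(1), of "k mod d x"] D_pos[OF Cons.prems(1)] by auto
    then have step: "?\<delta> x j = \<delta> x k" "?\<delta> y j = \<delta> y k"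
      using letter_mod[of x k] letter_mod[of y k] Cons.prems cs by (auto simp: recolor_def)
    have "rep (\<delta> x k) = rep (\<delta> y k)"
      using rep_step Cons.prems by metis
    then obtain w where "foldl ?\<delta> (\<delta> x k) w = run (\<delta> x k) u" "foldl ?\<delta> (\<delta> y k) w = run (\<delta> y k) u"
      using Cons.IH closed Cons.prems by blast
    then show ?case using step by (intro exI[of _ "j # w"]) simp
  qed
  show "r.stab x y" if xy: "x \<in> V" "y \<in> V" "c x = c y" for x y
    unfolding r.stab_def
  proof
    fix u
    have "qr.stab (rep x) (rep y)" using sync xy rep by simp
    \<comment> \<open>The word \<open>v\<close> brings both states into one stability class; a
      merging word of the old colouring, recoded by \<open>transl\<close>, finishes.\<close>
    then obtain v where v: "foldl ?q (rep x) (u @ v) = foldl ?q (rep y) (u @ v)"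
      unfolding qr.stab_def by blast
    let ?x = "foldl ?\<delta> x (u @ v)" and ?y = "foldl ?\<delta> y (u @ v)"
    have V: "?x \<in> V" "?y \<in> V" by (rule r.run_in, fact)+
    have eq: "rep ?x = rep ?y" using v proj xy by metis
    then have "stab ?x ?y" using rep_eq_iff V by blast
    then obtain w where "run ?x w = run ?y w" unfolding stab_def by (metis append_Nil)
    then obtain w' where "foldl ?\<delta> ?x w' = foldl ?\<delta> ?y w'" using transl[OF V eq, of w] by metis
    then have "foldl ?\<delta> x (u @ (v @ w')) = foldl ?\<delta> y (u @ (v @ w'))" by simp
    then show "\<exists>v. foldl ?\<delta> x (u @ v) = foldl ?\<delta> y (u @ v)" by blast
  qed
qed

lemma recolor_recolor: "recolor d \<rho>' (recolor d \<rho> \<delta>) = recolor d (\<lambda>x k. \<rho> x (\<rho>' x k mod d x)) \<delta>"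
  by (simp add: recolor_def fun_eq_iff)

lemma recoloring_comp:
  assumes "recoloring \<rho>" "recoloring \<rho>'"
  shows "recoloring (\<lambda>x k. \<rho> x (\<rho>' x k mod d x))"
  unfolding recoloring_def
proof
  fix x assume x: "x \<in> V"
  then have b': "bij_betw (\<rho>' x) {..<d x} {..<d x}" and "bij_betw (\<rho> x) {..<d x} {..<d x}"
    using assms unfolding recoloring_def by blast+
  then have b: "bij_betw (\<rho> x \<circ> \<rho>' x) {..<d x} {..<d x}" by (rule bij_betw_trans)
  have "\<rho> x (\<rho>' x k mod d x) = (\<rho> x \<circ> \<rho>' x) k" if "k \<in> {..<d x}" for k
    using bij_betwE[OF b'] that by simp
  then show "bij_betw (\<lambda>k. \<rho> x (\<rho>' x k mod d x)) {..<d x} {..<d x}"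
    using b by (subst bij_betw_cong)
qed

end

section \<open>Induction on the number of states\<close>

theorem periodic_road_coloring:
  assumes "periodic_automaton V c N D \<delta>"
  shows "\<exists>\<rho>. periodic_automaton.recoloring V c D \<rho> \<and> (\<forall>x\<in>V. \<forall>y\<in>V. c x = c y \<longrightarrow>
    periodic_automaton.stab (recolor (\<lambda>x. D (c x)) \<rho> \<delta>) x y)"
  using assms
proof (induction "card V" arbitrary: V \<delta> rule: less_induct)
  case less
  interpret periodic_automaton V c N D \<delta> by (fact less.prems)
  show ?case
  proof (cases "\<exists>x\<in>V. \<exists>y\<in>V. x \<noteq> y \<and> c x = c y")
    case False
    interpret r: periodic_automaton V c N D "recolor d (\<lambda>x k. k) \<delta>"
      by (rule recolor_automaton[OF recoloring_id])
    have "r.stab x y" if "x \<in> V" "y \<in> V" "c x = c y" for x y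
      using that False r.stab_refl by metis
    then show ?thesis using recoloring_id by blast
  next
    case True
    then obtain \<rho> x y where \<rho>: "recoloring \<rho>" and xy: "x \<in> V" "y \<in> V" "x \<noteq> y" "c x = c y"
      "periodic_automaton.stab (recolor d \<rho> \<delta>) x y"
      using ex_recoloring_stab_pair by blast
    interpret r: periodic_automaton V c N D "recolor d \<rho> \<delta>" by (rule recolor_automaton[OF \<rho>])
    have card: "card (r.rep ` V) < card V" using r.quotient_card xy by blast
    obtain \<rho>' where "periodic_automaton.recoloring (r.rep ` V) c D \<rho>'"
      "\<And>x y. x \<in> r.rep ` V \<Longrightarrow> y \<in> r.rep ` V \<Longrightarrow> c x = c y \<Longrightarrow>
         periodic_automaton.stab (recolor d \<rho>' r.quot) x y"
      using less.hyps[OF card r.quotient_automaton] by blast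
    \<comment> \<open>The lifted recolouring acts on the automaton already recoloured by
      \<open>\<rho>\<close>, so the two have to be composed.\<close>
    note lift = r.lift_recoloring[OF this]
    show ?thesis
      using recoloring_comp[OF \<rho> lift(1)] lift(2) unfolding recolor_recolor by blast
  qed
qed

section \<open>Graphs and their periods\<close>

lemma (in wf_digraph) awalk_iff_relpow:
  assumes "x \<in> verts G"
  shows "(\<exists>u. awalk x u y \<and> length u = l) \<longleftrightarrow> (x, y) \<in> arcs_ends G ^^ l"
  using assms
proof (induction l arbitrary: x)
  case 0
  then show ?case by (auto simp: awalk_Nil_iff)
next
  case (Suc l)
  have "(\<exists>u. awalk x u y \<and> length u = Suc l) \<longleftrightarrow>
    (\<exists>e\<in>arcs G. tail G e = x \<and> (\<exists>u. awalk (head G e) u y \<and> length u = l))"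
  proof -
    have "(\<exists>u. awalk x u y \<and> length u = Suc l) \<longleftrightarrow> (\<exists>e u. awalk x (e # u) y \<and> length u = l)"
      by (metis length_Suc_conv)
    then show ?thesis by (auto simp: awalk_Cons_iff)
  qed
  also have "\<dots> \<longleftrightarrow> (\<exists>e\<in>arcs G. tail G e = x \<and> (head G e, y) \<in> arcs_ends G ^^ l)"
    using Suc.IH head_in_verts by blast
  also have "\<dots> \<longleftrightarrow> (x, y) \<in> arcs_ends G ^^ Suc l"
    by (auto simp: arcs_ends_conv relpow_Suc_E2 simp del: relpow.simps intro!: relpow_Suc_I2 elim!: relpow_Suc_E2)
  finally show ?case .
qed

lemma strongly_connected_awalk:
  assumes "wf_digraph G" "strongly_connected G" "x \<in> verts G" "y \<in> verts G"
  obtains u where "pre_digraph.awalk G x u y"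
  using assms wf_digraph.reachable_awalk[OF assms(1)] unfolding strongly_connected_def by blast

lemma period_dvd:
  assumes "wf_digraph G" "pre_digraph.awalk G x u x"
  shows "period G dvd length u"
proof (cases "u = []")
  case False
  then show ?thesis unfolding period_def using assms by (intro Gcd_dvd) blast
qed simp

lemma period_greatest:
  assumes "\<And>x u. pre_digraph.awalk G x u x \<Longrightarrow> n dvd length u"
  shows "n dvd period G"
  unfolding period_def by (rule Gcd_greatest) (use assms in auto)

lemma sink_free_graphD:
  assumes "sink_free_graph G"
  shows "fin_digraph G" "wf_digraph G" "\<And>x. x \<in> verts G \<Longrightarrow> \<exists>e\<in>arcs G. tail G e = x"
  using assms by (auto simp: sink_free_graph_def fin_digraph_def)

lemma strongly_connected_period_pos:
  assumes "sink_free_graph G" "strongly_connected G"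
  shows "0 < period G"
proof -
  interpret wf_digraph G using sink_free_graphD[OF assms(1)] by simp
  obtain x where x: "x \<in> verts G" using assms(2) by (auto simp: strongly_connected_def)
  obtain e where e: "e \<in> arcs G" "tail G e = x" using sink_free_graphD(3)[OF assms(1) x] by blast
  obtain u where "awalk (head G e) u x"
    using strongly_connected_awalk[OF wf_digraph assms(2) head_in_verts[OF e(1)] x] .
  then have "awalk x (e # u) x" using e by (simp add: awalk_Cons_iff)
  then have "period G dvd length (e # u)" by (rule period_dvd[OF wf_digraph])
  then show ?thesis using dvd_pos_nat[of "length (e # u)" "period G"] by simp
qed

lemma position_awalk:
  assumes "wf_digraph G" and "\<And>e. e \<in> arcs G \<Longrightarrow> c (head G e) = Suc (c (tail G e)) mod N"
    and "c x < N" "pre_digraph.awalk G x u y"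
  shows "c y = (c x + length u) mod N"
proof -
  interpret wf_digraph G by fact
  show ?thesis using assms(3,4)
  proof (induction u arbitrary: x)
    case Nil
    then show ?case by (simp add: awalk_Nil_iff)
  next
    case (Cons e u)
    then have e: "e \<in> arcs G" "tail G e = x" and w: "awalk (head G e) u y"
      by (auto simp: awalk_Cons_iff)
    have "c (head G e) < N" using assms(2)[OF e(1)] Cons.prems by simp
    from Cons.IH[OF this w] show ?case using assms(2)[OF e(1)] e by (simp add: mod_simps)
  qed
qed

text \<open>The position is the length modulo the period of any path from \<open>J\<close>: two
  paths to the same state are closed by one common path back.\<close>

lemma ex_position:
  assumes "sink_free_graph G" "strongly_connected G" "J \<in> verts G"
  obtains c where "c J = 0" "\<And>x. c x < period G"
    "\<And>e. e \<in> arcs G \<Longrightarrow> c (head G e) = Suc (c (tail G e)) mod period G"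
proof -
  interpret wf_digraph G using sink_free_graphD[OF assms(1)] by simp
  let ?N = "period G"
  have N: "0 < ?N" by (rule strongly_connected_period_pos[OF assms(1,2)])
  have le: "length u mod ?N = length v mod ?N"
    if uv: "awalk J u x" "awalk J v x" and le: "length v \<le> length u" for u v x
  proof -
    obtain b where b: "awalk x b J"
      using strongly_connected_awalk[OF wf_digraph assms(2) _ assms(3)] uv(1) awalk_last_in_verts by blast
    have "?N dvd length (u @ b)" "?N dvd length (v @ b)"
      by (rule period_dvd[OF wf_digraph awalk_appendI[OF _ b]], fact)+
    then have "?N dvd length (u @ b) - length (v @ b)" by (rule dvd_diff_nat)
    then show ?thesis using le by (simp add: mod_eq_dvd_iff_nat)
  qed
  have eq: "length u mod ?N = length v mod ?N" if "awalk J u x" "awalk J v x" for u v x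
    using le that by (metis nat_le_linear)
  define c where "c x = length (SOME u. awalk J u x) mod ?N" for x
  have c: "c x = length u mod ?N" if "awalk J u x" for u x
    unfolding c_def using someI[of "\<lambda>u. awalk J u x", OF that] that by (rule eq)
  show thesis
  proof
    show "c J = 0" using c[of "[]" J] assms(3) by (simp add: awalk_Nil_iff)
    show "c x < ?N" for x using N by (simp add: c_def)
    fix e assume e: "e \<in> arcs G"
    obtain u where u: "awalk J u (tail G e)"
      using strongly_connected_awalk[OF wf_digraph assms(2,3) tail_in_verts[OF e]] .
    then have w: "awalk J (u @ [e]) (head G e)" using awalk_appendI arc_implies_awalk[OF e] by blast
    then show "c (head G e) = Suc (c (tail G e)) mod ?N" using c[OF u] c[OF w] by (simp add: mod_simps)
  qed
qed

section \<open>Road colouring for graphs\<close>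

lemma bunches_simps [simp]:
  "verts (bunches L) = {..<length L}" "tail (bunches L) = fst"
  "head (bunches L) (i, k) = Suc i mod length L"
  "(i, k) \<in> arcs (bunches L) \<longleftrightarrow> i < length L \<and> k < L ! i"
  "head (bunches L) a = Suc (fst a) mod length L"
  by (auto simp: bunches_def split: prod.splits)

lemma out_arcs_bunches: "i < length L \<Longrightarrow> out_arcs (bunches L) i = Pair i ` {..<L ! i}"
  by (auto simp: out_arcs_def)

lemma sink_free_bunches:
  assumes "\<And>i. i < length L \<Longrightarrow> 0 < L ! i"
  shows "sink_free_graph (bunches L)"
proof -
  have "arcs (bunches L) = (SIGMA i:{..<length L}. {..<L ! i})" by (auto simp: bunches_def)
  then have fin: "finite (arcs (bunches L))" by simp
  have "fin_digraph (bunches L)"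
    by unfold_locales (use fin in \<open>auto simp del: bunches_simps(3) intro!: mod_less_divisor\<close>)
  then show ?thesis unfolding sink_free_graph_def
    using assms by (auto simp: out_arcs_bunches)
qed

theorem bunches_le_S:
  assumes G: "sink_free_graph G" "strongly_connected G"
    and c_less: "\<And>x. x \<in> verts G \<Longrightarrow> c x < period G"
    and c_step: "\<And>e. e \<in> arcs G \<Longrightarrow> c (head G e) = Suc (c (tail G e)) mod period G"
    and L: "length L = period G" "\<And>x. x \<in> verts G \<Longrightarrow> L ! c x = out_degree G x"
  shows "bunches L \<le>\<^sub>S G"
proof -
  interpret fin_digraph G using sink_free_graphD[OF G(1)] by simp
  let ?N = "period G" and ?H = "bunches L" and ?V = "verts G"
  let ?d = "\<lambda>x. L ! c x"
  obtain J where J: "J \<in> ?V" using G(2) by (auto simp: strongly_connected_def)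
  have out: "out_arcs G x \<noteq> {}" if "x \<in> ?V" for x using G(1) that by (simp add: sink_free_graph_def)
  have d_pos: "0 < ?d x" if "x \<in> ?V" for x
    using L(2)[OF that] out[OF that] by (simp add: out_degree_def card_gt_0_iff finite_out_arcs)
  have "\<exists>e. bij_betw e {..<?d x} (out_arcs G x)" if "x \<in> ?V" for x
    using ex_bij_betw_nat_finite[OF finite_out_arcs[of x]] L(2)[OF that]
    by (simp add: out_degree_def atLeast0LessThan)
  then obtain e where e: "\<And>x. x \<in> ?V \<Longrightarrow> bij_betw (e x) {..<?d x} (out_arcs G x)" by metis
  define \<delta> where "\<delta> x k = head G (e x (k mod ?d x))" for x k
  have e_out: "e x k \<in> out_arcs G x" if "x \<in> ?V" "k < ?d x" for x k
    using bij_betwE[OF e[OF that(1)]] that(2) by auto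
  have e_mod: "e x (k mod ?d x) \<in> out_arcs G x" if "x \<in> ?V" for x k
    using e_out[OF that] d_pos[OF that] by simp
  have steps: "steps ?V \<delta> = arcs_ends G"
  proof
    show "steps ?V \<delta> \<subseteq> arcs_ends G"
      using e_mod by (force simp: steps_def \<delta>_def arcs_ends_conv)
    show "arcs_ends G \<subseteq> steps ?V \<delta>"
    proof
      fix z assume "z \<in> arcs_ends G"
      then obtain a where a: "a \<in> arcs G" "z = (tail G a, head G a)" by (auto simp: arcs_ends_conv)
      then have "a \<in> e (tail G a) ` {..<?d (tail G a)}"
        using e[OF tail_in_verts[OF a(1)]] by (simp add: bij_betw_def)
      then obtain k where "k < ?d (tail G a)" "a = e (tail G a) k" by auto
      then have "head G a = \<delta> (tail G a) k" by (simp add: \<delta>_def)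
      then show "z \<in> steps ?V \<delta>" using a by (auto simp: steps_def)
    qed
  qed
  interpret pa: periodic_automaton ?V c ?N "\<lambda>i. L ! i" \<delta>
  proof
    show "(x, y) \<in> (steps ?V \<delta>)\<^sup>*" if "x \<in> ?V" "y \<in> ?V" for x y
      using G(2) that reachable_rtranclI[of G x y] unfolding steps strongly_connected_def by simp
    show "n dvd ?N" if "\<And>x l. x \<in> ?V \<Longrightarrow> (x, x) \<in> steps ?V \<delta> ^^ l \<Longrightarrow> n dvd l" for n
    proof (rule period_greatest)
      fix x u assume u: "awalk x u x"
      then have "x \<in> ?V" by (rule awalk_hd_in_verts)
      then show "n dvd length u" using that awalk_iff_relpow u unfolding steps by blast
    qed
    show "\<delta> x k \<in> ?V" if "x \<in> ?V" for x k using e_mod[OF that, of k] by (simp add: \<delta>_def)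
    show "c (\<delta> x k) = Suc (c x) mod ?N" if "x \<in> ?V" for x k
      using e_mod[OF that, of k] c_step by (simp add: \<delta>_def)
  qed (use c_less d_pos in \<open>auto simp: \<delta>_def\<close>)
  obtain \<rho> where \<rho>: "pa.recoloring \<rho>"
    and sync: "\<And>x y. x \<in> ?V \<Longrightarrow> y \<in> ?V \<Longrightarrow> c x = c y \<Longrightarrow>
      periodic_automaton.stab (recolor ?d \<rho> \<delta>) x y"
    using periodic_road_coloring[OF pa.periodic_automaton_axioms] by blast
  let ?\<gamma> = "recolor ?d \<rho> \<delta>"
  interpret r: periodic_automaton ?V c ?N "\<lambda>i. L ! i" ?\<gamma> by (rule pa.recolor_automaton[OF \<rho>])
  \<comment> \<open>The edge of colour \<open>k\<close> at \<open>x\<close> in the synchronizing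
    colouring; below, \<open>\<phi>\<close> records position and colour of an edge.\<close>
  define \<beta> where "\<beta> x k = e x (\<rho> x k)" for x k
  have \<beta>: "bij_betw (\<beta> x) {..<?d x} (out_arcs G x)" if "x \<in> ?V" for x
  proof -
    have "bij_betw (e x \<circ> \<rho> x) {..<?d x} (out_arcs G x)"
      using \<rho> e[OF that] that unfolding pa.recoloring_def by (blast intro: bij_betw_trans)
    moreover have "\<beta> x = e x \<circ> \<rho> x" by (simp add: \<beta>_def fun_eq_iff)
    ultimately show ?thesis by simp
  qed
  have \<gamma>: "?\<gamma> x k = head G (\<beta> x k)" if "x \<in> ?V" "k < ?d x" for x k
  proof -
    have "\<rho> x k < ?d x" using \<rho> that bij_betwE unfolding pa.recoloring_def by blast
    then show ?thesis using that by (simp add: recolor_def \<delta>_def \<beta>_def)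
  qed
  define \<phi> where "\<phi> a = (c (tail G a), inv_into {..<?d (tail G a)} (\<beta> (tail G a)) a)" for a
  have \<phi>\<beta>: "\<phi> (\<beta> x k) = (c x, k)" if "x \<in> ?V" "k < ?d x" for x k
  proof -
    have "tail G (\<beta> x k) = x" using bij_betwE[OF \<beta>[OF that(1)]] that(2) by auto
    then show ?thesis using bij_betw_inv_into_left[OF \<beta>[OF that(1)]] that(2) by (simp add: \<phi>_def)
  qed
  have \<phi>_bij: "bij_betw \<phi> (out_arcs G x) (out_arcs ?H (c x))" if x: "x \<in> ?V" for x
  proof -
    have "bij_betw (Pair (c x) \<circ> inv_into {..<?d x} (\<beta> x)) (out_arcs G x) (Pair (c x) ` {..<?d x})"
      by (rule bij_betw_trans[OF bij_betw_inv_into[OF \<beta>[OF x]]]) (auto simp: bij_betw_def inj_on_def)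
    moreover have "(Pair (c x) \<circ> inv_into {..<?d x} (\<beta> x)) a = \<phi> a" if "a \<in> out_arcs G x" for a
      using that by (simp add: \<phi>_def)
    ultimately show ?thesis using bij_betw_cong out_arcs_bunches c_less[OF x] L(1)
      by (metis (no_types, lifting))
  qed
  have c_surj: "\<exists>x\<in>?V. c x = i" if "i < ?N" for i
  proof -
    have "\<exists>x\<in>?V. c x = (c J + n) mod ?N" for n
      using r.c_run[OF J, of "replicate n 0"] r.run_in[OF J, of "replicate n 0"] by auto
    \<comment> \<open>Adding \<open>?N\<close> prevents truncated subtraction.\<close>
    from this[of "i + ?N - c J"] show ?thesis using c_less[OF J] that by auto
  qed
  have sfH: "sink_free_graph ?H"
    using c_surj d_pos L(1) by (intro sink_free_bunches) metis
  interpret H: fin_digraph ?H using sink_free_graphD[OF sfH] by simp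
  have arcsG: "arcs G = (\<Union>x\<in>?V. out_arcs G x)" by auto
  have arcsH: "arcs ?H = (\<Union>x\<in>?V. out_arcs ?H (c x))"
  proof
    show "arcs ?H \<subseteq> (\<Union>x\<in>?V. out_arcs ?H (c x))"
      using c_surj L(1) by (fastforce simp: out_arcs_def)
  qed auto
  have rr: "right_resolver G ?H \<phi> c"
    unfolding right_resolver_def graph_hom_def
  proof (intro conjI ballI)
    show img: "\<phi> ` arcs G = arcs ?H"
      unfolding arcsG arcsH image_UN using \<phi>_bij by (simp add: bij_betw_def)
    then show "\<phi> ` arcs G \<subseteq> arcs ?H" by simp
    show "c ` ?V = verts ?H" using c_less c_surj L(1) by auto
    then show "c ` ?V \<subseteq> verts ?H" by simp
    show "tail ?H (\<phi> a) = c (tail G a)" for a by (simp add: \<phi>_def)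
    show "head ?H (\<phi> a) = c (head G a)" if "a \<in> arcs G" for a
      using that c_step L(1) by (simp add: \<phi>_def)
  qed (use G sfH \<phi>_bij in auto)
  \<comment> \<open>Along a path of \<open>bunches L\<close> the first components are dictated by
    the positions, so only the colours \<open>map snd u\<close> drive the lifted path.\<close>
  have lift: "K = c (foldl ?\<gamma> x (map snd u)) \<and>
      (\<exists>p. awalk x p (foldl ?\<gamma> x (map snd u)) \<and> map \<phi> p = u)"
    if "x \<in> ?V" "H.awalk (c x) u K" for x u K
    using that
  proof (induction u arbitrary: x)
    case Nil
    then show ?case by (auto simp: H.awalk_Nil_iff awalk_Nil_iff)
  next
    case (Cons a u)
    obtain k where k: "a = (c x, k)" "k < ?d x" and w: "H.awalk (Suc (c x) mod ?N) u K"
      using Cons.prems L(1) by (cases a) (auto simp: H.awalk_Cons_iff)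
    have b: "\<beta> x k \<in> arcs G" "tail G (\<beta> x k) = x"
      using bij_betwE[OF \<beta>[OF Cons.prems(1)]] k(2) by auto
    have g: "?\<gamma> x k = head G (\<beta> x k)" by (rule \<gamma>[OF Cons.prems(1) k(2)])
    have V: "?\<gamma> x k \<in> ?V" using r.closed Cons.prems(1) by blast
    have "H.awalk (c (?\<gamma> x k)) u K" using w r.c_step[OF Cons.prems(1)] by simp
    from Cons.IH[OF V this] obtain p where p: "K = c (foldl ?\<gamma> (?\<gamma> x k) (map snd u))"
      "awalk (?\<gamma> x k) p (foldl ?\<gamma> (?\<gamma> x k) (map snd u))" "map \<phi> p = u" by blast
    have "awalk x (\<beta> x k # p) (foldl ?\<gamma> x (map snd (a # u)))"
      using p(2) b g k(1) by (simp add: awalk_Cons_iff)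
    moreover have "map \<phi> (\<beta> x k # p) = a # u" using p(3) \<phi>\<beta>[OF Cons.prems(1) k(2)] k(1) by simp
    ultimately show ?case using p(1) k(1) by auto
  qed
  have lift_unique: "p = p'" if "awalk x p y" "awalk x p' y'" "map \<phi> p = map \<phi> p'" for x p p' y y'
    using that
  proof (induction p arbitrary: x p')
    case (Cons a p)
    then obtain a' q where q: "p' = a' # q" "\<phi> a = \<phi> a'" "map \<phi> p = map \<phi> q" by (cases p') auto
    have a: "a \<in> out_arcs G x" "a' \<in> out_arcs G x" "x \<in> ?V"
      using Cons.prems q by (auto simp: awalk_Cons_iff)
    then have "a = a'" using \<phi>_bij[OF a(3)] q(2) by (auto simp: bij_betw_def dest: inj_onD)
    then show ?case using Cons.IH[of "head G a" q] Cons.prems q by (auto simp: awalk_Cons_iff)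
  qed simp
  have act: "act G \<phi> x u = foldl ?\<gamma> x (map snd u)" if x: "x \<in> ?V" and u: "H.awalk (c x) u K" for x u K
  proof -
    obtain p where p: "awalk x p (foldl ?\<gamma> x (map snd u))" "map \<phi> p = u" using lift[OF x u] by blast
    have "(THE p. (\<exists>y. awalk x p y) \<and> map \<phi> p = u) = p"
      by (rule the_equality) (use p lift_unique in blast)+
    then show ?thesis unfolding act_def using awlast_of_awalk[OF p(1)] awalkE[OF p(1)] by auto
  qed
  \<comment> \<open>Merging words of \<open>stab\<close> have arbitrary letters. Reducing each
    letter modulo the out-degree at its position gives a genuine path acting alike on the whole
    fiber.\<close>
  have reduce: "\<exists>v' K'. H.awalk K v' K' \<and> (\<forall>x\<in>?V. c x = K \<longrightarrow> foldl ?\<gamma> x (map snd v') = foldl ?\<gamma> x v)"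
    if "K < ?N" for v K
    using that
  proof (induction v arbitrary: K)
    case Nil
    then show ?case using L(1) by (intro exI[of _ "[]"] exI[of _ K]) (simp add: H.awalk_Nil_iff)
  next
    case (Cons k v)
    obtain z where z: "z \<in> ?V" "c z = K" using c_surj Cons.prems by blast
    let ?k = "k mod (L ! K)"
    have k: "?k < L ! K" using d_pos[OF z(1)] z(2) by simp
    have "Suc K mod ?N < ?N" using Cons.prems by simp
    from Cons.IH[OF this] obtain v' K' where v': "H.awalk (Suc K mod ?N) v' K'"
      "\<And>x. x \<in> ?V \<Longrightarrow> c x = Suc K mod ?N \<Longrightarrow> foldl ?\<gamma> x (map snd v') = foldl ?\<gamma> x v" by blast
    have "H.awalk K ((K, ?k) # v') K'"
      using v'(1) k Cons.prems L(1) by (simp add: H.awalk_Cons_iff)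
    moreover have "foldl ?\<gamma> x (map snd ((K, ?k) # v')) = foldl ?\<gamma> x (k # v)" if "x \<in> ?V" "c x = K" for x
      using r.letter_mod[OF that(1), of k] that v'(2)[OF r.closed[OF that(1)]] r.c_step[OF that(1)] by simp
    ultimately show ?case by blast
  qed
  have stable: "(x, y) \<in> stable G ?H \<phi> c" if xy: "x \<in> ?V" "y \<in> ?V" "c x = c y" for x y
    unfolding stable_def
  proof (intro CollectI case_prodI conjI allI impI)
    fix u K assume u: "H.awalk (c x) u K"
    obtain v where v: "foldl ?\<gamma> x (map snd u @ v) = foldl ?\<gamma> y (map snd u @ v)"
      using sync[OF xy] unfolding r.stab_def by blast
    have K: "K = c (foldl ?\<gamma> x (map snd u))" "K = c (foldl ?\<gamma> y (map snd u))"
      using lift[OF xy(1) u] lift[OF xy(2)] u xy(3) by auto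
    have V: "foldl ?\<gamma> x (map snd u) \<in> ?V" "foldl ?\<gamma> y (map snd u) \<in> ?V"
      using r.run_in xy by auto
    obtain v' K' where v': "H.awalk K v' K'"
      "\<And>z. z \<in> ?V \<Longrightarrow> c z = K \<Longrightarrow> foldl ?\<gamma> z (map snd v') = foldl ?\<gamma> z v"
      using reduce[of K v] K(1) c_less V(1) by blast
    have w: "H.awalk (c x) (u @ v') K'" using H.awalk_appendI[OF u v'(1)] .
    have "act G \<phi> x (u @ v') = act G \<phi> y (u @ v')"
      using act[OF xy(1) w] act[OF xy(2), of "u @ v'" K'] w xy(3) v v'(2)[OF V(1)] v'(2)[OF V(2)] K by simp
    then show "\<exists>v K'. H.awalk K v K' \<and> act G \<phi> x (u @ v) = act G \<phi> y (u @ v)" using v'(1) by blast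
  qed (use xy in auto)
  have "{x \<in> ?V. c x = i} \<in> ?V // stable G ?H \<phi> c" if "i \<in> verts ?H" for i
  proof -
    have "i < ?N" using that L(1) by simp
    then obtain x where x: "x \<in> ?V" "c x = i" using c_surj by blast
    have "{x \<in> ?V. c x = i} = stable G ?H \<phi> c `` {x}"
      using stable x by (auto simp: stable_def)
    then show ?thesis using x(1) quotientI by metis
  qed
  then show ?thesis using rr unfolding le_S_def synchronizer_def by blast
qed

section \<open>Cycles of bunches\<close>

lemma concat_replicate_nth:
  "i < q * length xs \<Longrightarrow> concat (replicate q xs) ! i = xs ! (i mod length xs)"
  by (induction q arbitrary: i) (auto simp: nth_append le_mod_geq)

lemma length_concat_replicate: "length (concat (replicate q xs)) = q * length xs"
  by (induction q) auto

lemma cycle_of_bunches_next: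
  assumes M: "cycle_of_bunches M" and e: "e \<in> arcs M"
  shows "head M e = the_elem (followers M (tail M e))"
proof -
  have "tail M e \<in> verts M" using M e by (auto simp: cycle_of_bunches_def dest: sink_free_graphD(2) wf_digraph.tail_in_verts)
  then obtain y where y: "followers M (tail M e) = {y}" using M by (auto simp: cycle_of_bunches_def card_1_singleton_iff)
  moreover have "head M e \<in> followers M (tail M e)" using e by (auto simp: followers_def)
  ultimately show ?thesis by simp
qed

text \<open>With one follower per state, start and length of a path determine its end, so the states
  form a single orbit of \<open>F\<close>.\<close>

lemma cycle_of_bunches_orbit:
  fixes M :: "('a, 'b) pre_digraph"
  assumes M: "cycle_of_bunches M" and I: "I \<in> verts M"
  defines "F \<equiv> \<lambda>x. the_elem (followers M x)"
  shows "card (verts M) = period M" "(F ^^ (l mod period M)) I = (F ^^ l) I"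
    "x \<in> verts M \<Longrightarrow> (F ^^ l) x = x \<Longrightarrow> period M dvd l"
    "pre_digraph.awalk M x u y \<Longrightarrow> y = (F ^^ length u) x"
proof -
  have sf: "sink_free_graph M" and sc: "strongly_connected M" using M by (auto simp: cycle_of_bunches_def)
  interpret wf_digraph M using sink_free_graphD[OF sf] by simp
  have head: "head M e = F (tail M e)" if "e \<in> arcs M" for e
    using cycle_of_bunches_next[OF M that] by (simp add: F_def)
  have FV: "F \<in> verts M \<rightarrow> verts M"
  proof
    fix x assume "x \<in> verts M"
    then obtain e where "e \<in> arcs M" "tail M e = x" using sink_free_graphD(3)[OF sf] by blast
    then show "F x \<in> verts M" using head[of e] head_in_verts[of e] by simp
  qed
  have walk: "y = (F ^^ length u) x" if "awalk x u y" for x u y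
    using that by (induction u arbitrary: x) (auto simp: awalk_simps head funpow_swap1)
  then show "awalk x u y \<Longrightarrow> y = (F ^^ length u) x" .
  have orbit: "\<exists>n. (F ^^ n) x = y" if "x \<in> verts M" "y \<in> verts M" for x y
    using strongly_connected_awalk[OF wf_digraph sc that] walk by metis
  obtain n where "(F ^^ n) (F I) = I" using orbit[of "F I" I] FV I by auto
  then have "(F ^^ Suc n) I = I" by (simp add: funpow_swap1)
  then have "I \<in> cyc (verts M) F" using I unfolding cyc_def by blast
  then obtain n where n: "0 < n" "\<And>l. (F ^^ (l mod n)) I = (F ^^ l) I" "card (verts M) = n"
    "\<And>z l. z \<in> verts M \<Longrightarrow> (F ^^ l) z = z \<Longrightarrow> n dvd l"
    using single_orbit[OF FV _ orbit[OF I]] by metis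
  have "n dvd period M"
    by (rule period_greatest) (use n(4) walk awalk_hd_in_verts in metis)
  moreover have "period M dvd n"
  proof -
    have "\<exists>u y. awalk x u y \<and> length u = l" if "x \<in> verts M" for x l
      using that
    proof (induction l arbitrary: x)
      case 0
      then show ?case by (auto simp: awalk_Nil_iff)
    next
      case (Suc l)
      obtain e where e: "e \<in> arcs M" "tail M e = x" using sink_free_graphD(3)[OF sf Suc.prems] by blast
      then obtain u y where "awalk (head M e) u y" "length u = l" using Suc.IH[of "head M e"] by auto
      then have "awalk x (e # u) y \<and> length (e # u) = Suc l" using e by (simp add: awalk_Cons_iff)
      then show ?case by blast
    qed
    then obtain u y where u: "awalk I u y" "length u = n" using I by blast
    have "y = I" using walk[OF u(1)] u(2) n(2)[of n] by simp
    then show ?thesis using period_dvd[OF wf_digraph] u by metis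
  qed
  ultimately have "n = period M" by (rule dvd_antisym)
  then show "card (verts M) = period M" "(F ^^ (l mod period M)) I = (F ^^ l) I"
    "x \<in> verts M \<Longrightarrow> (F ^^ l) x = x \<Longrightarrow> period M dvd l"
    using n by auto
qed

lemma graph_hom_awalk:
  assumes "wf_digraph G" "wf_digraph H" "graph_hom G H \<phi> \<psi>" "pre_digraph.awalk G x u y"
  shows "pre_digraph.awalk H (\<psi> x) (map \<phi> u) (\<psi> y)"
proof -
  interpret G: wf_digraph G by fact
  interpret H: wf_digraph H by fact
  show ?thesis using assms(4)
    by (induction u arbitrary: x) (use assms(3) in \<open>auto simp: graph_hom_def G.awalk_simps H.awalk_simps\<close>)
qed

theorem theorem4p3:
  fixes G :: "('a,'b) pre_digraph" and M :: "('c,'d) pre_digraph" and I\<^sub>0 :: 'c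
  assumes "sink_free_graph G"
    and "strongly_connected G"
    and "is_M G M"
    and "cycle_of_bunches M"
    and "I\<^sub>0 \<in> verts M"
  shows "O_graph M I\<^sub>0 (period G div period M) \<le>\<^sub>S G"
proof -
  obtain \<phi> \<psi> where rr: "right_resolver G M \<phi> \<psi>" using assms(3) by (auto simp: is_M_def le_R_def)
  then have hom: "graph_hom G M \<phi> \<psi>" and \<psi>: "\<psi> ` verts G = verts M"
    and bij: "\<And>x. x \<in> verts G \<Longrightarrow> bij_betw \<phi> (out_arcs G x) (out_arcs M (\<psi> x))"
    by (auto simp: right_resolver_def)
  have sfM: "sink_free_graph M" using assms(4) by (simp add: cycle_of_bunches_def)
  interpret G: wf_digraph G using sink_free_graphD[OF assms(1)] by simp
  have wfM: "wf_digraph M" using sink_free_graphD[OF sfM] by simp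
  define F where "F = (\<lambda>x. the_elem (followers M x))"
  let ?N = "period G" and ?p = "period M"
  note orbit = cycle_of_bunches_orbit[OF assms(4,5), folded F_def]
  have walk: "\<psi> y = (F ^^ length u) (\<psi> x)" if "G.awalk x u y" for x u y
    using orbit(4)[OF graph_hom_awalk[OF G.wf_digraph wfM hom that]] by simp
  \<comment> \<open>Closed paths of \<open>G\<close> map to closed paths of \<open>M\<close>, whose
    lengths are multiples of \<open>?p\<close>.\<close>
  have p_dvd: "?p dvd ?N"
  proof (rule period_greatest)
    fix x u assume u: "G.awalk x u x"
    then have "\<psi> x \<in> verts M" using \<psi> G.awalk_hd_in_verts by blast
    then show "?p dvd length u" using orbit(3) walk[OF u] by metis
  qed
  \<comment> \<open>Counting positions from a state over \<open>I\<^sub>0\<close> aligns position 0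
    with the first entry of the list of out-degrees.\<close>
  obtain J where J: "J \<in> verts G" "\<psi> J = I\<^sub>0" using \<psi> assms(5) by (metis imageE)
  obtain c where c: "c J = 0" "\<And>x. c x < ?N"
    "\<And>e. e \<in> arcs G \<Longrightarrow> c (head G e) = Suc (c (tail G e)) mod ?N"
    using ex_position[OF assms(1,2) J(1)] by metis
  \<comment> \<open>A path from \<open>J\<close> projects to as many steps of \<open>F\<close>, and
    the position gives its length modulo \<open>?N\<close>, hence modulo \<open>?p\<close>.\<close>
  have \<psi>_c: "\<psi> x = (F ^^ (c x mod ?p)) I\<^sub>0" if x: "x \<in> verts G" for x
  proof -
    obtain u where u: "G.awalk J u x"
      using strongly_connected_awalk[OF G.wf_digraph assms(2) J(1) x] .
    have "c x = length u mod ?N"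
      using position_awalk[OF G.wf_digraph c(3) c(2) u] c(1) by simp
    then have "c x mod ?p = length u mod ?p" using p_dvd by (simp add: mod_mod_cancel)
    then show ?thesis using walk[OF u] J(2) orbit(2) by simp
  qed
  define q where "q = ?N div ?p"
  define Ds where "Ds = out_degrees_from M I\<^sub>0"
  have N: "q * ?p = ?N" using p_dvd by (simp add: q_def)
  have lenD: "length Ds = ?p" by (simp add: Ds_def out_degrees_from_def orbit(1))
  have p_pos: "0 < ?p" using strongly_connected_period_pos sfM assms(4) by (auto simp: cycle_of_bunches_def)
  have "bunches (concat (replicate q Ds)) \<le>\<^sub>S G"
  proof (rule bunches_le_S[OF assms(1,2) c(2) c(3)])
    show "length (concat (replicate q Ds)) = ?N" by (simp add: length_concat_replicate lenD N)
    fix x assume x: "x \<in> verts G"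
    have "concat (replicate q Ds) ! c x = Ds ! (c x mod ?p)"
      using c(2)[of x] by (subst concat_replicate_nth) (simp_all add: lenD N)
    also have "\<dots> = out_degree M ((F ^^ (c x mod ?p)) I\<^sub>0)"
      using p_pos by (simp add: Ds_def out_degrees_from_def orbit(1) F_def)
    also have "\<dots> = out_degree M (\<psi> x)" using \<psi>_c[OF x] by simp
    also have "\<dots> = out_degree G x" using bij_betw_same_card[OF bij[OF x]] by (simp add: out_degree_def)
    finally show "concat (replicate q Ds) ! c x = out_degree G x" .
  qed
  then show ?thesis by (simp add: O_graph_def q_def Ds_def)
qed

end
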